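(* Let $\mathbb G$ be a nontrivial finite group and let $T$ be a free simplicial $\mathbb G$-complex such that $\mathrm{ind}_{\mathbb G}(T)=n$. Let $\lambda:V(T)\to\mathbb G\times[m]$ be a $\mathbb G$-equivariant labeling such that there is no edge in $T$ whose vertices are labelled with $(g,j)$ and $(g',j)$ with $g\neq g'$ and $j\in[m]$. Then there is at least one simplex in $T$ whose vertices are labelled with labels $(g_0,j_0),(g_1,j_1),\ldots,(g_n,j_n)$, where $g_i\neq g_{i+1}$ and $j_i<j_{i+1}$ for all $i\in\{0,1,\ldots,n-1\}$. In particular, $m\geq n+1$.
   Context: Simplicial complexes are finite. A simplicial $\mathbb G$-complex is a simplicial complex with a $\mathbb G$-action on its vertices by simplicial maps; it is free if no non-identity element fixes a simplex. $\mathbb G$ acts on $\mathbb G\times[m]$ by $h\cdot(g,j)=(hg,j)$; $\lambda$ is equivariant if $\lambda(h\cdot v)=h\cdot\lambda(v)$ for all $h\in\mathbb G$, $v\in V(T)$. $E_n\mathbb G$ denotes any free $(n-1)$-connected $n$-dimensional simplicial $\mathbb G$-complex, e.g. the $(n+1)$-fold join $\mathbb G^{*(n+1)}$ of the discrete set $\mathbb G$. For a $\mathbb G$-space $X$, $\mathrm{ind}_{\mathbb G}(X)$ is the least $n$ such that there is a continuous $\mathbb G$-equivariant map $X\to E_n\mathbb G$ (independent of the choice of $E_n\mathbb G$); for a simplicial complex $K$, $\mathrm{ind}_{\mathbb G}(K)$ means $\mathrm{ind}_{\mathbb G}(\|K\|)$, with $\|K\|$ the geometric realization. *)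

theory Defs
  imports "HOL-Analysis.Analysis" "HOL-Algebra.Group_Action" "HOL-Library.Extended_Real"
begin

text \<open>
  Finite abstract simplicial complexes are given by their sets of simplices. The empty
  simplex is not a member; every vertex is a simplex, so the vertex set is the union.
\<close>

definition finite_complex :: "'v set set \<Rightarrow> bool" where
  "finite_complex K \<longleftrightarrow>
     finite K \<and> (\<forall>s\<in>K. finite s \<and> s \<noteq> {}) \<and> (\<forall>s\<in>K. \<forall>t. t \<subseteq> s \<and> t \<noteq> {} \<longrightarrow> t \<in> K)"

abbreviation vertices :: "'v set set \<Rightarrow> 'v set" where
  "vertices K \<equiv> \<Union>K"

definition complex_dim :: "'v set set \<Rightarrow> int" where
  "complex_dim K = (if K = {} then -1 else int (Max (card ` K)) - 1)"

text \<open>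
  Points of the geometric realization are given by their barycentric coordinates. As the
  complex is finite, the product topology is the usual topology on the realization.
\<close>

definition realization_set :: "'v set set \<Rightarrow> ('v \<Rightarrow> real) set" where
  "realization_set K =
     {x. (\<forall>v. 0 \<le> x v) \<and> {v. x v \<noteq> 0} \<in> K \<and> (\<Sum>v | x v \<noteq> 0. x v) = 1}"

definition realization :: "'v set set \<Rightarrow> ('v \<Rightarrow> real) topology" where
  "realization K = subtopology (powertop_real UNIV) (realization_set K)"

text \<open>The affine extension to realizations of a map \<open>f\<close> on the vertices of \<open>K\<close>.\<close>

definition realization_map ::
    "'v set set \<Rightarrow> ('v \<Rightarrow> 'w) \<Rightarrow> ('v \<Rightarrow> real) \<Rightarrow> ('w \<Rightarrow> real)" where
  "realization_map K f x = (\<lambda>w. \<Sum>v | v \<in> vertices K \<and> f v = w. x v)"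

definition G_complex ::
    "('g, 'b) monoid_scheme \<Rightarrow> 'v set set \<Rightarrow> ('g \<Rightarrow> 'v \<Rightarrow> 'v) \<Rightarrow> bool" where
  "G_complex G K \<phi> \<longleftrightarrow>
     finite_complex K \<and> group_action G (vertices K) \<phi> \<and>
     (\<forall>h\<in>carrier G. \<forall>s\<in>K. \<phi> h ` s \<in> K)"

text \<open>A simplex is fixed if it is mapped to itself, not necessarily pointwise.\<close>

definition free_G_complex ::
    "('g, 'b) monoid_scheme \<Rightarrow> 'v set set \<Rightarrow> ('g \<Rightarrow> 'v \<Rightarrow> 'v) \<Rightarrow> bool" where
  "free_G_complex G K \<phi> \<longleftrightarrow>
     G_complex G K \<phi> \<and>
     (\<forall>h\<in>carrier G. h \<noteq> \<one>\<^bsub>G\<^esub> \<longrightarrow> (\<forall>s\<in>K. \<phi> h ` s \<noteq> s))"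

text \<open>
  \<open>k\<close>-connectedness in the sense of homotopy. Being \<open>(-1)\<close>-connected means being nonempty;
  for smaller \<open>k\<close> there is no condition. The sphere \<open>nsphere i\<close> has dimension \<open>i\<close>.
\<close>

definition k_connected :: "int \<Rightarrow> 'a topology \<Rightarrow> bool" where
  "k_connected k X \<longleftrightarrow>
     (- 1 \<le> k \<longrightarrow> topspace X \<noteq> {}) \<and>
     (\<forall>i f. int i \<le> k \<and> continuous_map (nsphere i) X f \<longrightarrow>
        (\<exists>c. homotopic_with (\<lambda>_. True) (nsphere i) X f (\<lambda>_. c)))"

definition is_EnG ::
    "('g, 'b) monoid_scheme \<Rightarrow> int \<Rightarrow> 'v set set \<Rightarrow> ('g \<Rightarrow> 'v \<Rightarrow> 'v) \<Rightarrow> bool" where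
  "is_EnG G n E \<psi> \<longleftrightarrow>
     free_G_complex G E \<psi> \<and> complex_dim E = n \<and> k_connected (n - 1) (realization E)"

text \<open>
  The index of a \<open>G\<close>-space \<open>X\<close> with action \<open>\<alpha>\<close>: the least \<open>n\<close> admitting an equivariant map
  into some \<open>E\<^sub>nG\<close>, and \<open>\<infinity>\<close> if there is none. Vertices of type \<open>nat\<close> are no restriction, since
  the complexes are finite. For \<open>n = -1\<close> the only \<open>E\<^sub>nG\<close> is the empty complex, so the empty
  space, and no other, has index \<open>-1\<close>.
\<close>

definition G_index ::
    "('g, 'b) monoid_scheme \<Rightarrow> 'a topology \<Rightarrow> ('g \<Rightarrow> 'a \<Rightarrow> 'a) \<Rightarrow> ereal" where
  "G_index G X \<alpha> =
     Inf {ereal (real_of_int n) | n.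
       \<exists>(E :: nat set set) \<psi> f. is_EnG G n E \<psi> \<and> continuous_map X (realization E) f \<and>
         (\<forall>h\<in>carrier G. \<forall>x\<in>topspace X. f (\<alpha> h x) = realization_map E (\<psi> h) (f x))}"

definition complex_index ::
    "('g, 'b) monoid_scheme \<Rightarrow> 'v set set \<Rightarrow> ('g \<Rightarrow> 'v \<Rightarrow> 'v) \<Rightarrow> ereal" where
  "complex_index G K \<phi> = G_index G (realization K) (\<lambda>h. realization_map K (\<phi> h))"

definition label_action :: "('g, 'b) monoid_scheme \<Rightarrow> 'g \<Rightarrow> 'g \<times> nat \<Rightarrow> 'g \<times> nat" where
  "label_action G h = (\<lambda>(g, j). (h \<otimes>\<^bsub>G\<^esub> g, j))"

end

theory Submission
  imports Defs
begin

text \<open>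
  Suppose that no simplex carries an alternating sequence of \<open>n + 1\<close> labels. Assign to a simplex \<open>S\<close> of
  \<open>T\<close> the pair \<open>(g, r)\<close>, where \<open>r < n\<close> is the largest number of steps of an alternating sequence in \<open>S\<close>
  and \<open>g\<close> is the group element in the label of lowest level in \<open>S\<close>. This is equivariant. If \<open>S\<close> is a
  face of \<open>S'\<close> and both have the same \<open>r\<close>, then they have the same \<open>g\<close>: a new group element at the
  bottom of \<open>S'\<close> could be put in front of a longest alternating sequence of \<open>S\<close>
  (\<open>bottom_label_eq_of_max_alternation_eq\<close>). So the assignment is simplicial from the
  barycentric subdivision of \<open>T\<close> to the \<open>n\<close>-fold join of \<open>G\<close>. The latter is an \<open>E\<^bsub>n-1\<^esub>G\<close>, and the
  index of \<open>T\<close> is at most \<open>n - 1\<close> (\<open>complex_index_le\<close>), a contradiction. The bound on \<open>m\<close> follows, as the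
  levels along an alternating sequence increase strictly.

  It must be shown that the \<open>k\<close>-fold join of a nonempty discrete set is \<open>(k - 2)\<close>-connected
  (\<open>k_connected_discrete_join\<close>). Choose a base vertex on each of the \<open>k\<close> levels. One explicit formula
  pushes a point of the join towards the simplex of base vertices, at a speed \<open>d j\<close> on level \<open>j\<close>. It
  breaks down only at points whose masses on the \<open>k\<close> levels, off the base
  vertices, are exactly the entries of \<open>d\<close>. For a map from a sphere of dimension \<open>i \<le> k - 2\<close>, these masses
  form a map into a space of dimension \<open>k - 1 > i\<close>. So after a small
  perturbation they miss a point (\<open>perturbation_misses_point\<close>), and a direction \<open>d\<close> that depends
  continuously on the point of the sphere can be chosen so as to avoid the breakdown everywhere.
\<close>

section \<open>Maps from a sphere into a space of larger dimension\<close>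

lemma nsphere_eq_top_of_set: "nsphere i = top_of_set (topspace (nsphere i))"
  by (simp add: nsphere euclidean_product_topology)

lemma continuous_on_coordinate [continuous_intros]:
  "continuous_on A (\<lambda>x::'a \<Rightarrow> real. x l)"
  by (rule continuous_on_subset[OF continuous_on_product_coordinates subset_UNIV])

lemma mem_sphere_iff:
  "s \<in> topspace (nsphere i) \<longleftrightarrow> (\<Sum>l\<le>i. (s l)\<^sup>2) = 1 \<and> (\<forall>l>i. s l = 0)"
  by (auto simp: nsphere)

lemma sphere_coordinate_bound:
  assumes "s \<in> topspace (nsphere i)"
  shows "\<bar>s l\<bar> \<le> 1"
proof (cases "l \<le> i")
  case True
  have "(s l)\<^sup>2 \<le> (\<Sum>l\<le>i. (s l)\<^sup>2)"
    by (rule member_le_sum) (use True in auto)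
  then show ?thesis
    using assms by (simp add: mem_sphere_iff abs_square_le_1)
qed (use assms in \<open>simp add: mem_sphere_iff\<close>)

lemma compact_sphere: "compact (topspace (nsphere i))"
proof -
  have "compactin (powertop_real (UNIV::nat set)) (PiE UNIV (\<lambda>_. {-1..1}))"
    by (simp add: compactin_PiE)
  then have "compact (PiE (UNIV::nat set) (\<lambda>_. {-1..1::real}))"
    by (simp add: euclidean_product_topology)
  moreover have "closed (topspace (nsphere i))"
  proof -
    have "topspace (nsphere i) = {s. (\<Sum>l\<le>i. (s l)\<^sup>2) = 1} \<inter> (\<Inter>l\<in>{i<..}. {s. s l = 0})"
      by (auto simp: mem_sphere_iff)
    moreover have "closed {s::nat\<Rightarrow>real. (\<Sum>l\<le>i. (s l)\<^sup>2) = 1}"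
      by (intro closed_Collect_eq continuous_intros)
    moreover have "closed (\<Inter>l\<in>{i<..}. {s::nat\<Rightarrow>real. s l = 0})"
      by (intro closed_INT ballI closed_Collect_eq continuous_intros)
    ultimately show ?thesis by (simp add: closed_Int)
  qed
  moreover have "topspace (nsphere i) \<subseteq> PiE UNIV (\<lambda>_. {-1..1})"
    using sphere_coordinate_bound by (fastforce simp: abs_le_iff)
  ultimately show ?thesis
    by (metis compact_Int_closed inf.absorb_iff2)
qed

definition coord_dist :: "nat \<Rightarrow> (nat \<Rightarrow> real) \<Rightarrow> (nat \<Rightarrow> real) \<Rightarrow> real" where
  "coord_dist i s s' = (\<Sum>l\<le>i. \<bar>s l - s' l\<bar>)"

lemma coord_dist_nonneg: "0 \<le> coord_dist i s s'"
  by (simp add: coord_dist_def sum_nonneg)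

definition lipschitz_on_sphere :: "nat \<Rightarrow> ((nat \<Rightarrow> real) \<Rightarrow> real) \<Rightarrow> bool" where
  "lipschitz_on_sphere i q \<longleftrightarrow>
     (\<exists>L\<ge>0. \<forall>s\<in>topspace (nsphere i). \<forall>s'\<in>topspace (nsphere i).
        \<bar>q s - q s'\<bar> \<le> L * coord_dist i s s')"

lemma lipschitz_on_sphere_continuous:
  assumes "lipschitz_on_sphere i q"
  shows "continuous_on (topspace (nsphere i)) q"
  unfolding continuous_on_def
proof
  fix s0 assume s0: "s0 \<in> topspace (nsphere i)"
  obtain L where L: "\<And>s. s \<in> topspace (nsphere i) \<Longrightarrow> \<bar>q s - q s0\<bar> \<le> L * coord_dist i s s0"
    using assms s0 unfolding lipschitz_on_sphere_def by meson
  let ?F = "at s0 within topspace (nsphere i)"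
  have "continuous_on UNIV (\<lambda>s. L * coord_dist i s s0)"
    unfolding coord_dist_def by (intro continuous_intros)
  then have "continuous_on (topspace (nsphere i)) (\<lambda>s. L * coord_dist i s s0)"
    by (rule continuous_on_subset) simp
  then have lim: "((\<lambda>s. L * coord_dist i s s0) \<longlongrightarrow> 0) ?F"
    using s0 unfolding continuous_on_def by (fastforce simp: coord_dist_def)
  have "((\<lambda>s. q s - q s0) \<longlongrightarrow> 0) ?F"
  proof (rule Lim_null_comparison[OF _ lim])
    show "\<forall>\<^sub>F s in ?F. norm (q s - q s0) \<le> L * coord_dist i s s0"
      using L by (auto simp: eventually_at_filter)
  qed
  then show "(q \<longlongrightarrow> q s0) ?F"
    by (simp add: LIM_zero_iff)
qed

lemma lipschitz_on_sphere_mult: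
  assumes "lipschitz_on_sphere i f" and "lipschitz_on_sphere i g"
  shows "lipschitz_on_sphere i (\<lambda>s. f s * g s)"
proof -
  let ?S = "topspace (nsphere i)"
  have bdd: "\<exists>B\<ge>0. \<forall>s\<in>?S. \<bar>h s\<bar> \<le> B" if "lipschitz_on_sphere i h" for h
  proof -
    have "bounded (h ` ?S)"
      by (intro compact_imp_bounded compact_continuous_image lipschitz_on_sphere_continuous
          compact_sphere that)
    then obtain B where "\<forall>s\<in>?S. \<bar>h s\<bar> \<le> B"
      by (auto simp: bounded_iff)
    then show ?thesis
      by (intro exI[of _ "max 0 B"]) auto
  qed
  obtain B C where B: "B \<ge> 0" "\<forall>s\<in>?S. \<bar>f s\<bar> \<le> B" and C: "C \<ge> 0" "\<forall>s\<in>?S. \<bar>g s\<bar> \<le> C"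
    using bdd[OF assms(1)] bdd[OF assms(2)] by blast
  obtain L where L: "L \<ge> 0" "\<forall>s\<in>?S. \<forall>s'\<in>?S. \<bar>f s - f s'\<bar> \<le> L * coord_dist i s s'"
    using assms(1) unfolding lipschitz_on_sphere_def by blast
  obtain M where M: "M \<ge> 0" "\<forall>s\<in>?S. \<forall>s'\<in>?S. \<bar>g s - g s'\<bar> \<le> M * coord_dist i s s'"
    using assms(2) unfolding lipschitz_on_sphere_def by blast
  show ?thesis
    unfolding lipschitz_on_sphere_def
  proof (intro exI[of _ "B * M + C * L"] conjI ballI)
    fix s s' assume s: "s \<in> ?S" "s' \<in> ?S"
    have "\<bar>f s * g s - f s' * g s'\<bar> = \<bar>f s * (g s - g s') + (f s - f s') * g s'\<bar>"
      by (simp add: algebra_simps)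
    also have "\<dots> \<le> \<bar>f s\<bar> * \<bar>g s - g s'\<bar> + \<bar>f s - f s'\<bar> * \<bar>g s'\<bar>"
      by (metis abs_mult abs_triangle_ineq)
    also have "\<dots> \<le> B * (M * coord_dist i s s') + (L * coord_dist i s s') * C"
      by (intro add_mono mult_mono) (use B C L M s coord_dist_nonneg in auto)
    finally show "\<bar>f s * g s - f s' * g s'\<bar> \<le> (B * M + C * L) * coord_dist i s s'"
      by (simp add: algebra_simps)
  qed (use B C L M in auto)
qed

lemma lipschitz_on_sphere_add:
  assumes "lipschitz_on_sphere i f" and "lipschitz_on_sphere i g"
  shows "lipschitz_on_sphere i (\<lambda>s. f s + g s)"
proof -
  let ?S = "topspace (nsphere i)"
  obtain L where L: "L \<ge> 0" "\<forall>s\<in>?S. \<forall>s'\<in>?S. \<bar>f s - f s'\<bar> \<le> L * coord_dist i s s'"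
    using assms(1) unfolding lipschitz_on_sphere_def by blast
  obtain M where M: "M \<ge> 0" "\<forall>s\<in>?S. \<forall>s'\<in>?S. \<bar>g s - g s'\<bar> \<le> M * coord_dist i s s'"
    using assms(2) unfolding lipschitz_on_sphere_def by blast
  show ?thesis
    unfolding lipschitz_on_sphere_def
  proof (intro exI[of _ "L + M"] conjI ballI)
    fix s s' assume "s \<in> ?S" "s' \<in> ?S"
    then have "\<bar>f s - f s'\<bar> \<le> L * coord_dist i s s'" "\<bar>g s - g s'\<bar> \<le> M * coord_dist i s s'"
      using L M by auto
    then show "\<bar>f s + g s - (f s' + g s')\<bar> \<le> (L + M) * coord_dist i s s'"
      by (simp add: algebra_simps)
  qed (use L M in auto)
qed

text \<open>
  The Lipschitz functions form an algebra that contains the coordinates, so it separates points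
  and the Stone-Weierstrass theorem applies.
\<close>

lemma lipschitz_approximation_on_sphere:
  assumes "continuous_on (topspace (nsphere i)) f" and "\<epsilon> > 0"
  obtains q where "lipschitz_on_sphere i q" "\<forall>s\<in>topspace (nsphere i). \<bar>f s - q s\<bar> < \<epsilon>"
proof -
  interpret function_ring_on "Collect (lipschitz_on_sphere i)" "topspace (nsphere i)"
  proof
    fix s s' assume s: "s \<in> topspace (nsphere i)" "s' \<in> topspace (nsphere i)" and "s \<noteq> s'"
    then obtain l where l: "s l \<noteq> s' l"
      by auto
    then have "l \<le> i"
      using s by (simp add: mem_sphere_iff) (metis not_le)
    then have "lipschitz_on_sphere i (\<lambda>s. s l)"
      unfolding lipschitz_on_sphere_def coord_dist_def
      by (intro exI[of _ 1]) (auto intro: member_le_sum[of l "{..i}" "\<lambda>l. \<bar>_ l - _ l\<bar>"])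
    with l show "\<exists>f\<in>Collect (lipschitz_on_sphere i). f s \<noteq> f s'"
      by (intro bexI[of _ "\<lambda>s. s l"]) auto
  next
    show "\<And>c. (\<lambda>_. c) \<in> Collect (lipschitz_on_sphere i)"
      by (auto simp: lipschitz_on_sphere_def intro!: exI[of _ 0])
  qed (auto simp: compact_sphere lipschitz_on_sphere_continuous lipschitz_on_sphere_add
      lipschitz_on_sphere_mult)
  show ?thesis
    using Stone_Weierstrass_basic[OF assms] that by (elim bexE) simp
qed

text \<open>
  The sphere has to be cut into \<open>O(N\<^sup>i)\<close> pieces of diameter \<open>O(1/N)\<close>; rounding all \<open>i + 1\<close>
  coordinates would give \<open>O(N\<^bsup>i+1\<^esup>)\<close> pieces, which is one factor \<open>N\<close> too many. A coordinate that is
  bounded away from \<open>0\<close> is a Lipschitz function of its sign and of the other coordinates,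
  since the squares add up to \<open>1\<close>. So that coordinate need not be rounded.
\<close>

lemma sphere_large_coordinate:
  assumes "s \<in> topspace (nsphere i)"
  shows "\<exists>j\<le>i. 1 \<le> real (i + 1) * \<bar>s j\<bar>"
proof (rule ccontr)
  assume *: "\<not> ?thesis"
  have "(\<Sum>j\<le>i. (s j)\<^sup>2) < (\<Sum>j\<le>i. 1 / real (i + 1))"
  proof (rule sum_strict_mono)
    fix j assume "j \<in> {..i}"
    then have "\<bar>s j\<bar> < 1 / real (i + 1)"
      using * by (auto simp: field_simps)
    moreover have "(s j)\<^sup>2 \<le> \<bar>s j\<bar>"
      using mult_left_le[OF sphere_coordinate_bound[OF assms, of j], of "\<bar>s j\<bar>"]
      by (simp add: power2_eq_square)
    ultimately show "(s j)\<^sup>2 < 1 / real (i + 1)" by linarith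
  qed auto
  then show False
    using assms by (simp add: mem_sphere_iff)
qed

text \<open>
  The piece of \<open>s\<close> is given by the key \<open>\<kappa> s\<close>: the index of a large coordinate, its sign, and the
  other coordinates rounded to multiples of \<open>1/N\<close>. The constant \<open>C\<close> serves for the number of
  keys and for the diameter of the pieces alike.
\<close>

lemma sphere_cover:
  obtains C :: real where "C > 0"
    "\<And>N::nat. N > 0 \<Longrightarrow> \<exists>(K :: (nat \<times> bool \<times> (nat \<Rightarrow> int)) set) \<kappa>.
        finite K \<and> real (card K) \<le> C * real N ^ i \<and> \<kappa> ` topspace (nsphere i) \<subseteq> K \<and>
        (\<forall>s\<in>topspace (nsphere i). \<forall>s'\<in>topspace (nsphere i).
            \<kappa> s = \<kappa> s' \<longrightarrow> coord_dist i s s' \<le> C / N)"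
proof
  define C where "C = 2 * real (i + 1) ^ 2 * 3 ^ i"
  show "C > 0" by (simp add: C_def)
  fix N :: nat assume "N > 0"
  let ?S = "topspace (nsphere i)"
  define big where "big s = (SOME j. j \<le> i \<and> 1 \<le> real (i + 1) * \<bar>s j\<bar>)" for s
  have big: "big s \<le> i" "1 \<le> real (i + 1) * \<bar>s (big s)\<bar>" if "s \<in> ?S" for s
    using someI_ex[OF sphere_large_coordinate[OF that]] by (auto simp: big_def)
  define \<kappa> where
    "\<kappa> s = (big s, s (big s) > 0, restrict (\<lambda>l. \<lfloor>N * s l\<rfloor>) ({..i} - {big s}))"
    for s :: "nat \<Rightarrow> real"
  define K :: "(nat \<times> bool \<times> (nat \<Rightarrow> int)) set" where
    "K = (SIGMA j:{..i}. UNIV \<times> PiE ({..i} - {j}) (\<lambda>_. {-int N..int N}))"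
  have fin: "finite K"
    unfolding K_def by (intro finite_SigmaI finite_cartesian_product finite_PiE) auto
  have "nat (2 * int N + 1) = Suc (2 * N)"
    by linarith
  then have "card K = (\<Sum>j\<le>i. 2 * (2 * N + 1) ^ i)"
    unfolding K_def
    by (subst card_SigmaI) (auto simp: card_cartesian_product card_PiE intro!: finite_PiE)
  then have "real (card K) = real (i + 1) * 2 * real (2 * N + 1) ^ i"
    by (simp add: algebra_simps)
  also have "\<dots> \<le> real (i + 1) * 2 * (3 * real N) ^ i"
    using \<open>N > 0\<close> by (intro mult_left_mono power_mono) auto
  also have "\<dots> = 2 * real (i + 1) * 3 ^ i * real N ^ i"
    by (simp add: power_mult_distrib)
  also have "\<dots> \<le> C * real N ^ i"
    unfolding C_def power2_eq_square
    by (intro mult_right_mono) (auto simp: algebra_simps)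
  finally have card: "real (card K) \<le> C * real N ^ i" .
  have sub: "\<kappa> ` ?S \<subseteq> K"
  proof
    fix k assume "k \<in> \<kappa> ` ?S"
    then obtain s where s: "s \<in> ?S" "k = \<kappa> s" by auto
    have "\<lfloor>N * s l\<rfloor> \<in> {-int N..int N}" for l
    proof -
      have "\<bar>N * s l\<bar> \<le> N"
        using mult_left_mono[OF sphere_coordinate_bound[OF s(1), of l], of N] by (simp add: abs_mult)
      then show ?thesis
        by (simp add: abs_le_iff le_floor_iff floor_le_iff)
    qed
    then show "k \<in> K"
      unfolding s(2) \<kappa>_def K_def using big[OF s(1)] by auto
  qed
  have dist: "coord_dist i s s' \<le> C / N" if s: "s \<in> ?S" "s' \<in> ?S" and eq: "\<kappa> s = \<kappa> s'" for s s'
  proof -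
    let ?j = "big s"
    have j: "big s' = ?j" "(s' ?j > 0) = (s ?j > 0)"
      using eq by (auto simp: \<kappa>_def)
    \<comment> \<open>equal keys round all coordinates but the large one in the same way\<close>
    have near: "\<bar>s l - s' l\<bar> \<le> 1 / N" if l: "l \<in> {..i} - {?j}" for l
    proof -
      have "restrict (\<lambda>l. \<lfloor>N * s l\<rfloor>) ({..i} - {?j}) l = restrict (\<lambda>l. \<lfloor>N * s' l\<rfloor>) ({..i} - {?j}) l"
        using eq j unfolding \<kappa>_def by simp
      then have "\<lfloor>N * s l\<rfloor> = \<lfloor>N * s' l\<rfloor>"
        using l by simp
      then have "\<bar>N * s l - N * s' l\<bar> \<le> 1"
        by linarith
      then have "N * \<bar>s l - s' l\<bar> \<le> 1"
        by (metis abs_mult abs_of_nat right_diff_distrib)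
      then show ?thesis
        using \<open>N > 0\<close> by (simp add: field_simps)
    qed
    have decomp: "(\<Sum>l\<le>i. f l) = f ?j + (\<Sum>l\<in>{..i} - {?j}. f l)" for f :: "nat \<Rightarrow> real"
      using big(1)[OF s(1)] by (intro sum.remove) auto
    have bound: "(\<Sum>l\<in>{..i} - {?j}. \<bar>s l - s' l\<bar>) \<le> i / N"
    proof -
      have "(\<Sum>l\<in>{..i} - {?j}. \<bar>s l - s' l\<bar>) \<le> real (card ({..i} - {?j})) * (1 / N)"
        by (rule sum_bounded_above) (use near in auto)
      also have "card ({..i} - {?j}) = i"
        using big(1)[OF s(1)] by simp
      finally show ?thesis by simp
    qed
    \<comment> \<open>the large coordinates: first their squares, then the factor \<open>\<bar>s ?j\<bar> + \<bar>s' ?j\<bar>\<close> is divided out\<close>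
    have "\<bar>(s ?j)\<^sup>2 - (s' ?j)\<^sup>2\<bar> = \<bar>\<Sum>l\<in>{..i} - {?j}. (s' l)\<^sup>2 - (s l)\<^sup>2\<bar>"
    proof -
      have "(s ?j)\<^sup>2 + (\<Sum>l\<in>{..i} - {?j}. (s l)\<^sup>2) = 1"
        "(s' ?j)\<^sup>2 + (\<Sum>l\<in>{..i} - {?j}. (s' l)\<^sup>2) = 1"
        using s unfolding mem_sphere_iff decomp by auto
      then show ?thesis
        unfolding sum_subtractf by linarith
    qed
    also have "\<dots> \<le> (\<Sum>l\<in>{..i} - {?j}. 2 * \<bar>s l - s' l\<bar>)"
    proof (rule order_trans[OF sum_abs], rule sum_mono)
      fix l
      have "\<bar>(s' l)\<^sup>2 - (s l)\<^sup>2\<bar> = \<bar>s l + s' l\<bar> * \<bar>s l - s' l\<bar>"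
        by (simp add: abs_mult[symmetric] power2_eq_square algebra_simps abs_minus_commute)
      also have "\<dots> \<le> 2 * \<bar>s l - s' l\<bar>"
        using sphere_coordinate_bound[OF s(1), of l] sphere_coordinate_bound[OF s(2), of l]
        by (intro mult_right_mono) auto
      finally show "\<bar>(s' l)\<^sup>2 - (s l)\<^sup>2\<bar> \<le> 2 * \<bar>s l - s' l\<bar>" .
    qed
    also have "\<dots> = 2 * (\<Sum>l\<in>{..i} - {?j}. \<bar>s l - s' l\<bar>)"
      by (simp add: sum_distrib_left)
    also have "\<dots> \<le> 2 * (i / N)"
      using bound by simp
    finally have sq: "\<bar>(s ?j)\<^sup>2 - (s' ?j)\<^sup>2\<bar> \<le> 2 * (i / N)" .
    have "\<bar>(s ?j)\<^sup>2 - (s' ?j)\<^sup>2\<bar> = \<bar>s ?j - s' ?j\<bar> * (\<bar>s ?j\<bar> + \<bar>s' ?j\<bar>)"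
    proof -
      have "\<bar>s ?j + s' ?j\<bar> = \<bar>s ?j\<bar> + \<bar>s' ?j\<bar>"
        using j(2) by (auto simp: abs_if not_less)
      then show ?thesis
        by (metis abs_mult mult.commute power2_eq_square square_diff_square_factored)
    qed
    then have "real (i + 1) * (\<bar>s ?j\<bar> + \<bar>s' ?j\<bar>) * \<bar>s ?j - s' ?j\<bar> \<le> real (i + 1) * (2 * (i / N))"
      using mult_left_mono[OF sq, of "real (i + 1)"] by (simp add: algebra_simps)
    moreover have "2 \<le> real (i + 1) * (\<bar>s ?j\<bar> + \<bar>s' ?j\<bar>)"
      using big(2)[OF s(1)] big(2)[OF s(2)] j(1) by (simp add: algebra_simps)
    then have "2 * \<bar>s ?j - s' ?j\<bar> \<le> real (i + 1) * (\<bar>s ?j\<bar> + \<bar>s' ?j\<bar>) * \<bar>s ?j - s' ?j\<bar>"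
      by (rule mult_right_mono) simp
    ultimately have "2 * \<bar>s ?j - s' ?j\<bar> \<le> real (i + 1) * (2 * (i / N))"
      by (meson order_trans)
    then have "2 * \<bar>s ?j - s' ?j\<bar> \<le> 2 * (real (i + 1) * (i / N))"
      by (simp only: mult.left_commute)
    then have "\<bar>s ?j - s' ?j\<bar> \<le> real (i + 1) * (i / N)"
      by (rule mult_left_le_imp_le) simp
    then have "coord_dist i s s' \<le> real (i + 1) * (i / N) + i / N"
      using bound decomp[of "\<lambda>l. \<bar>s l - s' l\<bar>"] by (simp add: coord_dist_def)
    also have "\<dots> = (real (i + 1) * i + i) / N"
      by (simp add: add_divide_distrib)
    also have "\<dots> \<le> C / N"
    proof (rule divide_right_mono)
      have "real (i + 1) * i + i \<le> (2 * real (i + 1) ^ 2) * 1"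
        by (simp add: power2_eq_square algebra_simps)
      also have "\<dots> \<le> C"
        unfolding C_def by (intro mult_left_mono) auto
      finally show "real (i + 1) * i + i \<le> C" .
    qed simp
    finally show ?thesis .
  qed
  show "\<exists>(K :: (nat \<times> bool \<times> (nat \<Rightarrow> int)) set) \<kappa>.
        finite K \<and> real (card K) \<le> C * real N ^ i \<and> \<kappa> ` ?S \<subseteq> K \<and>
        (\<forall>s\<in>?S. \<forall>s'\<in>?S. \<kappa> s = \<kappa> s' \<longrightarrow> coord_dist i s s' \<le> C / N)"
    by (intro exI[of _ K] exI[of _ \<kappa>] conjI ballI impI fin card sub dist)
qed

text \<open>
  Pigeonhole replaces measure zero here. Take the \<open>M\<^sup>n\<close> points of a grid of mesh \<open>(b - a) / M\<close> in the
  cube and cut the sphere into pieces whose images are too small to contain two of them. This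
  takes a number of pieces proportional to \<open>M\<^sup>i\<close>, which is less than \<open>M\<^sup>n\<close> for large \<open>M\<close>.
\<close>

lemma lipschitz_image_of_sphere_misses_point:
  fixes q :: "nat \<Rightarrow> (nat \<Rightarrow> real) \<Rightarrow> real"
  assumes lip: "\<And>j. j < n \<Longrightarrow> lipschitz_on_sphere i (q j)" and "i < n" and "a < b"
  obtains c where "\<forall>j<n. a \<le> c j \<and> c j \<le> b" "\<forall>s\<in>topspace (nsphere i). \<exists>j<n. q j s \<noteq> c j"
proof -
  let ?S = "topspace (nsphere i)"
  have "\<forall>j. \<exists>L. j < n \<longrightarrow> L \<ge> 0 \<and> (\<forall>s\<in>?S. \<forall>s'\<in>?S. \<bar>q j s - q j s'\<bar> \<le> L * coord_dist i s s')"
    using lip unfolding lipschitz_on_sphere_def by blast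
  then obtain L0 where L0: "\<And>j. j < n \<Longrightarrow> L0 j \<ge> 0"
    "\<And>j s s'. j < n \<Longrightarrow> s \<in> ?S \<Longrightarrow> s' \<in> ?S \<Longrightarrow> \<bar>q j s - q j s'\<bar> \<le> L0 j * coord_dist i s s'"
    by metis
  define L where "L = (\<Sum>j<n. L0 j)"
  have "L \<ge> 0"
    unfolding L_def by (intro sum_nonneg) (use L0 in auto)
  have L: "\<bar>q j s - q j s'\<bar> \<le> L * coord_dist i s s'" if "j < n" "s \<in> ?S" "s' \<in> ?S" for j s s'
  proof -
    have "L0 j \<le> L"
      unfolding L_def by (rule member_le_sum) (use L0 that in auto)
    then show ?thesis
      using L0(2)[OF that] mult_right_mono[OF _ coord_dist_nonneg] by (meson order_trans)
  qed
  obtain C :: real where C: "C > 0" and cover: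
    "\<And>N::nat. N > 0 \<Longrightarrow> \<exists>(K :: (nat \<times> bool \<times> (nat \<Rightarrow> int)) set) \<kappa>.
        finite K \<and> real (card K) \<le> C * real N ^ i \<and> \<kappa> ` ?S \<subseteq> K \<and>
        (\<forall>s\<in>?S. \<forall>s'\<in>?S. \<kappa> s = \<kappa> s' \<longrightarrow> coord_dist i s s' \<le> C / N)"
    using sphere_cover[of i] by blast
  obtain R :: nat where R: "real R > L * C / (b - a)"
    using reals_Archimedean2 by blast
  have "R > 0"
    using R \<open>L \<ge> 0\<close> C \<open>a < b\<close> by (metis divide_nonneg_pos diff_gt_0_iff_gt less_eq_real_def
        mult_nonneg_nonneg not_le of_nat_0_less_iff order_less_le_trans order.strict_trans1)
  obtain M :: nat where M: "real M > C * real R ^ i"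
    using reals_Archimedean2 by blast
  have "M > 0"
    using M C by (metis gr0I less_eq_real_def mult_nonneg_nonneg not_le of_nat_0 of_nat_0_le_iff zero_le_power)
  obtain K :: "(nat \<times> bool \<times> (nat \<Rightarrow> int)) set" and \<kappa> where K: "finite K"
    "real (card K) \<le> C * real (M * R) ^ i" "\<kappa> ` ?S \<subseteq> K"
    and \<kappa>: "\<And>s s'. s \<in> ?S \<Longrightarrow> s' \<in> ?S \<Longrightarrow> \<kappa> s = \<kappa> s' \<Longrightarrow> coord_dist i s s' \<le> C / real (M * R)"
    using cover[of "M * R"] \<open>M > 0\<close> \<open>R > 0\<close> by auto
  define P where "P = PiE {..<n} (\<lambda>_. {..<M})"
  define pt where "pt p j = a + (b - a) * (real (p j) / M)" for p :: "nat \<Rightarrow> nat" and j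
  have "\<exists>p\<in>P. \<forall>s\<in>?S. \<exists>j<n. q j s \<noteq> pt p j"
  proof (rule ccontr)
    assume "\<not> ?thesis"
    then obtain \<sigma> where \<sigma>: "\<And>p. p \<in> P \<Longrightarrow> \<sigma> p \<in> ?S" "\<And>p j. p \<in> P \<Longrightarrow> j < n \<Longrightarrow> q j (\<sigma> p) = pt p j"
      by metis
    have "inj_on (\<lambda>p. \<kappa> (\<sigma> p)) P"
    proof (rule inj_onI)
      fix p p' assume p: "p \<in> P" "p' \<in> P" and eq: "\<kappa> (\<sigma> p) = \<kappa> (\<sigma> p')"
      have "p j = p' j" if j: "j < n" for j
      proof -
        have "(b - a) * \<bar>real (p j) - real (p' j)\<bar> / M = \<bar>pt p j - pt p' j\<bar>"
        proof -
          have "pt p j - pt p' j = (b - a) * (real (p j) - real (p' j)) / M"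
            by (simp add: pt_def right_diff_distrib diff_divide_distrib)
          then show ?thesis
            using \<open>a < b\<close> by (simp add: abs_mult)
        qed
        also have "\<dots> \<le> L * coord_dist i (\<sigma> p) (\<sigma> p')"
          using L[OF j \<sigma>(1)[OF p(1)] \<sigma>(1)[OF p(2)]] \<sigma>(2) p j by simp
        also have "\<dots> \<le> L * (C / real (M * R))"
          using \<kappa>[OF \<sigma>(1)[OF p(1)] \<sigma>(1)[OF p(2)] eq] \<open>L \<ge> 0\<close> by (rule mult_left_mono)
        also have "\<dots> < (b - a) / M"
          using R \<open>R > 0\<close> \<open>M > 0\<close> \<open>a < b\<close> by (simp add: field_simps)
        finally have "(b - a) * \<bar>real (p j) - real (p' j)\<bar> < (b - a) * 1"
          using \<open>M > 0\<close> by (simp add: divide_less_cancel)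
        then have "\<bar>real (p j) - real (p' j)\<bar> < 1"
          using \<open>a < b\<close> by (simp only: mult_less_cancel_left_pos diff_gt_0_iff_gt)
        then show ?thesis by linarith
      qed
      then show "p = p'"
        using p unfolding P_def by (intro PiE_ext) auto
    qed
    moreover have "(\<lambda>p. \<kappa> (\<sigma> p)) ` P \<subseteq> K"
      using \<sigma>(1) K(3) by auto
    ultimately have "card P \<le> card K"
      using K(1) card_inj_on_le by blast
    then have "real M ^ n \<le> C * real (M * R) ^ i"
      using K(2) by (simp add: P_def card_PiE) (metis of_nat_le_iff of_nat_power order_trans)
    also have "\<dots> = (C * real R ^ i) * real M ^ i"
      by (simp add: power_mult_distrib)
    also have "\<dots> < real M * real M ^ i"
      using M \<open>M > 0\<close> by simp
    also have "\<dots> \<le> real M ^ n"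
      using power_increasing[of "Suc i" n "real M"] \<open>i < n\<close> \<open>M > 0\<close> by simp
    finally show False by simp
  qed
  then obtain p where p: "p \<in> P" "\<forall>s\<in>?S. \<exists>j<n. q j s \<noteq> pt p j"
    by blast
  have "a \<le> pt p j \<and> pt p j \<le> b" if "j < n" for j
  proof -
    have "p j < M"
      using p(1) that by (auto simp: P_def)
    then have "real (p j) / M \<le> 1"
      by simp
    then show ?thesis
      using \<open>a < b\<close> mult_left_mono[of "real (p j) / M" 1 "b - a"] by (simp add: pt_def)
  qed
  with p(2) that[of "pt p"] show ?thesis
    by blast
qed

text \<open>
  Continuous maps can fill a cube of larger dimension, so a perturbation is needed: \<open>f - e\<close> is a
  Lipschitz approximation of \<open>f\<close>.
\<close>

lemma perturbation_misses_point:
  fixes f :: "nat \<Rightarrow> (nat \<Rightarrow> real) \<Rightarrow> real"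
  assumes cont: "\<And>j. j < n \<Longrightarrow> continuous_on (topspace (nsphere i)) (f j)"
    and "i < n" and "a < b" and "\<epsilon> > 0"
  obtains c e where "\<forall>j<n. a \<le> c j \<and> c j \<le> b"
    and "\<forall>j<n. continuous_on (topspace (nsphere i)) (e j)"
    and "\<forall>j<n. \<forall>s\<in>topspace (nsphere i). \<bar>e j s\<bar> < \<epsilon>"
    and "\<forall>s\<in>topspace (nsphere i). \<exists>j<n. f j s - e j s \<noteq> c j"
proof -
  let ?S = "topspace (nsphere i)"
  have "\<exists>q. lipschitz_on_sphere i q \<and> (\<forall>s\<in>?S. \<bar>f j s - q s\<bar> < \<epsilon>)" if "j < n" for j
    using lipschitz_approximation_on_sphere[OF cont[OF that] \<open>\<epsilon> > 0\<close>] by metis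
  then obtain q where q: "\<And>j. j < n \<Longrightarrow> lipschitz_on_sphere i (q j)"
    "\<And>j s. j < n \<Longrightarrow> s \<in> ?S \<Longrightarrow> \<bar>f j s - q j s\<bar> < \<epsilon>"
    by metis
  obtain c where c: "\<forall>j<n. a \<le> c j \<and> c j \<le> b" "\<forall>s\<in>?S. \<exists>j<n. q j s \<noteq> c j"
    using lipschitz_image_of_sphere_misses_point[of n i q, OF q(1) \<open>i < n\<close> \<open>a < b\<close>] by blast
  show ?thesis
  proof (rule that[of c "\<lambda>j s. f j s - q j s"])
    show "\<forall>j<n. continuous_on ?S (\<lambda>s. f j s - q j s)"
      using cont q(1) lipschitz_on_sphere_continuous by (intro allI impI continuous_on_diff) auto
  qed (use c q(2) in auto)
qed

section \<open>Connectivity of joins of discrete sets\<close>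

text \<open>
  The join of the discrete sets \<open>{v \<in> V. l v = j}\<close>, one for each level \<open>j\<close>.
\<close>

definition discrete_join :: "'w set \<Rightarrow> ('w \<Rightarrow> nat) \<Rightarrow> 'w set set" where
  "discrete_join V l = {s. s \<noteq> {} \<and> s \<subseteq> V \<and> inj_on l s}"

lemma realization_discrete_join_iff:
  assumes "finite V"
  shows "x \<in> realization_set (discrete_join V l) \<longleftrightarrow>
    (\<forall>v. 0 \<le> x v) \<and> {v. x v \<noteq> 0} \<subseteq> V \<and> inj_on l {v. x v \<noteq> 0} \<and> (\<Sum>v\<in>V. x v) = 1"
proof -
  have "(\<Sum>v | x v \<noteq> 0. x v) = (\<Sum>v\<in>V. x v)" if "{v. x v \<noteq> 0} \<subseteq> V"
    by (rule sum.mono_neutral_left) (use assms that in auto)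
  moreover have "{v. x v \<noteq> 0} \<noteq> {}" if "(\<Sum>v\<in>V. x v) = 1"
    using that by (metis (mono_tags, lifting) empty_iff mem_Collect_eq sum.neutral zero_neq_one)
  ultimately show ?thesis
    unfolding realization_set_def discrete_join_def by auto
qed

lemma realization_eq_top_of_set: "realization K = top_of_set (realization_set K)"
  by (simp add: realization_def euclidean_product_topology)

lemma continuous_map_realization_iff:
  "continuous_map (top_of_set S) (realization K) f \<longleftrightarrow>
     continuous_on S f \<and> f ` S \<subseteq> realization_set K"
  by (auto simp: realization_eq_top_of_set)

text \<open>
  A join of \<open>k\<close> nonempty discrete sets with a base vertex \<open>p j\<close> chosen on each level. The base
  vertices span a simplex, onto which as much of the realization as possible is to be pushed.
\<close>

locale pointed_join =
  fixes V :: "'w set" and l :: "'w \<Rightarrow> nat" and k :: nat and p :: "nat \<Rightarrow> 'w"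
  assumes finite_V: "finite V" and level_less: "v \<in> V \<Longrightarrow> l v < k"
    and base_in: "j < k \<Longrightarrow> p j \<in> V" and level_base: "j < k \<Longrightarrow> l (p j) = j"
begin

abbreviation J :: "'w set set" where
  "J \<equiv> discrete_join V l"

definition off_base :: "'w set" where
  "off_base = V - p ` {..<k}"

definition off_mass :: "('w \<Rightarrow> real) \<Rightarrow> nat \<Rightarrow> real" where
  "off_mass x j = (\<Sum>v | v \<in> off_base \<and> l v = j. x v)"

text \<open>
  The point at time \<open>t\<close> of the push towards the base simplex, up to normalization. While the weights
  of \<open>x\<close> fade with the factor \<open>1 - t\<close>, the amount \<open>t * d j\<close> is taken away on level \<open>j\<close> from the vertex
  off the base that carries weight there. What exceeds the weight of that vertex goes to the base
  vertex, so no two vertices of one level ever carry weight together.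
\<close>

definition slide :: "real \<Rightarrow> (nat \<Rightarrow> real) \<Rightarrow> ('w \<Rightarrow> real) \<Rightarrow> 'w \<Rightarrow> real" where
  "slide t d x v =
     (if v \<in> off_base then max 0 ((1 - t) * x v - t * d (l v))
      else if v \<in> V then (1 - t) * x v + max 0 (t * d (l v) - (1 - t) * off_mass x (l v))
      else 0)"

lemma off_base_subset: "off_base \<subseteq> V"
  by (auto simp: off_base_def)

lemma base_not_off_base: "j < k \<Longrightarrow> p j \<notin> off_base"
  by (auto simp: off_base_def)

lemma base_eq: "v \<in> V \<Longrightarrow> v \<notin> off_base \<Longrightarrow> v = p (l v)"
  using level_base by (auto simp: off_base_def)

lemma off_mass_nonneg: "x \<in> realization_set J \<Longrightarrow> 0 \<le> off_mass x j"
  unfolding off_mass_def realization_discrete_join_iff[OF finite_V] by (intro sum_nonneg) auto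

lemma off_mass_eq:
  assumes x: "x \<in> realization_set J" and v: "v \<in> off_base" "x v \<noteq> 0"
  shows "off_mass x (l v) = x v"
proof -
  have "off_mass x (l v) = (\<Sum>u\<in>{v}. x u)"
    unfolding off_mass_def
  proof (rule sum.mono_neutral_right)
    show "finite {u. u \<in> off_base \<and> l u = l v}"
      using finite_V off_base_subset by (simp add: finite_subset[of _ V] subset_iff)
    show "\<forall>u\<in>{u \<in> off_base. l u = l v} - {v}. x u = 0"
      using x v unfolding realization_discrete_join_iff[OF finite_V] by (auto dest: inj_onD)
  qed (use v in auto)
  then show ?thesis by simp
qed

lemma sum_off_mass:
  assumes x: "x \<in> realization_set J" and zero: "\<And>j. j < k \<Longrightarrow> x (p j) = 0"
  shows "(\<Sum>j<k. off_mass x j) = 1"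
proof -
  have "finite off_base"
    using off_base_subset finite_V finite_subset by blast
  have "(\<Sum>j<k. off_mass x j) = (\<Sum>v\<in>off_base. x v)"
    unfolding off_mass_def
  proof (rule sum.group[OF \<open>finite off_base\<close>])
    show "l ` off_base \<subseteq> {..<k}"
      using off_base_subset level_less by auto
  qed simp
  also have "\<dots> = (\<Sum>v\<in>V. x v)"
    by (rule sum.mono_neutral_left) (use finite_V off_base_subset zero in \<open>auto simp: off_base_def\<close>)
  finally show ?thesis
    using x unfolding realization_discrete_join_iff[OF finite_V] by simp
qed

lemma slide_nonneg:
  assumes "x \<in> realization_set J" and "t \<le> 1"
  shows "0 \<le> slide t d x v"
  using assms unfolding slide_def realization_discrete_join_iff[OF finite_V] by auto

text \<open>
  Normalization is possible unless everything vanishes. Then no base vertex has weight, and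
  \<open>(1 - t) * off_mass x j = t * d j\<close> on each level. Summing over the levels gives \<open>1 - t = t\<close>, so
  the only obstruction is that \<open>x\<close> has the level masses \<open>d\<close> at time \<open>1/2\<close>.
\<close>

lemma slide_mass_pos:
  assumes x: "x \<in> realization_set J" and t: "0 \<le> t" "t \<le> 1"
    and d: "\<And>j. j < k \<Longrightarrow> 0 < d j" "(\<Sum>j<k. d j) = 1"
    and avoid: "t = 1/2 \<Longrightarrow> \<exists>j<k. off_mass x j \<noteq> d j"
  shows "0 < (\<Sum>v\<in>V. slide t d x v)"
proof (rule ccontr)
  assume "\<not> ?thesis"
  moreover have "0 \<le> (\<Sum>v\<in>V. slide t d x v)"
    by (intro sum_nonneg slide_nonneg x t)
  ultimately have zero: "\<And>v. v \<in> V \<Longrightarrow> slide t d x v = 0"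
    using sum_nonneg_eq_0_iff[of V "slide t d x"] finite_V slide_nonneg[OF x t(2)] by auto
  have x0: "\<And>v. 0 \<le> x v"
    using x unfolding realization_discrete_join_iff[OF finite_V] by auto
  have base: "(1 - t) * x (p j) = 0 \<and> t * d j \<le> (1 - t) * off_mass x j" if "j < k" for j
  proof -
    have "slide t d x (p j) = (1 - t) * x (p j) + max 0 (t * d j - (1 - t) * off_mass x j)"
      using that base_in base_not_off_base level_base by (simp add: slide_def)
    moreover have "slide t d x (p j) = 0"
      using zero base_in that by blast
    moreover have "0 \<le> (1 - t) * x (p j)"
      using x0 t by simp
    ultimately show ?thesis by linarith
  qed
  have other: "(1 - t) * off_mass x j \<le> t * d j" if "j < k" for j
  proof (cases "\<exists>v\<in>off_base. l v = j \<and> x v \<noteq> 0")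
    case True
    then obtain v where v: "v \<in> off_base" "l v = j" "x v \<noteq> 0" by blast
    then have "(1 - t) * x v \<le> t * d j"
      using zero[of v] off_base_subset by (auto simp: slide_def split: if_splits)
    then show ?thesis
      using off_mass_eq[OF x v(1,3)] v(2) by simp
  next
    case False
    then have "off_mass x j = 0"
      unfolding off_mass_def by (intro sum.neutral) auto
    then show ?thesis
      using t d(1)[OF that] by simp
  qed
  have eq: "(1 - t) * off_mass x j = t * d j" if "j < k" for j
    using base[OF that] other[OF that] by linarith
  have "k \<noteq> 0"
    using d(2) by (intro notI) simp
  have "t \<noteq> 1"
    using eq[of 0] d(1)[of 0] \<open>k \<noteq> 0\<close> by auto
  then have "(\<Sum>j<k. off_mass x j) = 1"
    using base by (intro sum_off_mass[OF x]) auto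
  then have "(1 - t) * 1 = (\<Sum>j<k. (1 - t) * off_mass x j)"
    by (simp add: sum_distrib_left[symmetric])
  also have "\<dots> = (\<Sum>j<k. t * d j)"
    using eq by simp
  also have "\<dots> = t"
    using d(2) by (simp add: sum_distrib_left[symmetric])
  finally have "t = 1/2" by simp
  moreover have "off_mass x j = d j" if "j < k" for j
    using eq[OF that] \<open>t = 1/2\<close> by simp
  ultimately show False
    using avoid by blast
qed

lemma slide_support_inj:
  assumes x: "x \<in> realization_set J" and t: "0 \<le> t" "t \<le> 1" and d: "\<And>j. j < k \<Longrightarrow> 0 < d j"
  shows "inj_on l {v. slide t d x v \<noteq> 0}"
proof -
  have inj: "u = v" if "l u = l v" "x u \<noteq> 0" "x v \<noteq> 0" for u v
    using x that unfolding realization_discrete_join_iff[OF finite_V] by (auto dest: inj_onD)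
  have pos: "x v \<noteq> 0 \<and> t * d (l v) < (1 - t) * x v" if "v \<in> off_base" "slide t d x v \<noteq> 0" for v
  proof -
    have "t * d (l v) < (1 - t) * x v"
      using that by (auto simp: slide_def max_def split: if_splits)
    moreover have "0 \<le> t * d (l v)"
      using t d[of "l v"] level_less off_base_subset that(1) by (simp add: subset_iff less_imp_le)
    ultimately show ?thesis by auto
  qed
  have mixed: False if u: "u \<in> off_base" "slide t d x u \<noteq> 0" and v: "v \<in> V" "v \<notin> off_base" "slide t d x v \<noteq> 0"
    and l: "l u = l v" for u v
  proof -
    have "x v = 0"
      using pos[OF u] u(1) v(2) l inj by blast
    then have "slide t d x v = max 0 (t * d (l u) - (1 - t) * x u)"
      using v off_mass_eq[OF x u(1)] pos[OF u] l by (simp add: slide_def)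
    then show False
      using pos[OF u] v(3) by (simp add: max_def split: if_splits)
  qed
  show ?thesis
  proof (rule inj_onI)
    fix u v assume uv: "u \<in> {v. slide t d x v \<noteq> 0}" "v \<in> {v. slide t d x v \<noteq> 0}" and l: "l u = l v"
    then have V: "u \<in> V" "v \<in> V"
      using off_base_subset by (auto simp: slide_def split: if_splits)
    show "u = v"
    proof (cases "u \<in> off_base \<longleftrightarrow> v \<in> off_base")
      case True
      then show ?thesis
        using pos uv l inj base_eq V by (cases "u \<in> off_base") (blast, metis)
    next
      case False
      then show ?thesis
        using mixed[of u v] mixed[of v u] uv V l by auto
    qed
  qed
qed

lemma slide_in_realization:
  assumes x: "x \<in> realization_set J" and t: "0 \<le> t" "t \<le> 1"
    and d: "\<And>j. j < k \<Longrightarrow> 0 < d j" "(\<Sum>j<k. d j) = 1"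
    and avoid: "t = 1/2 \<Longrightarrow> \<exists>j<k. off_mass x j \<noteq> d j"
  shows "(\<lambda>v. slide t d x v / (\<Sum>u\<in>V. slide t d x u)) \<in> realization_set J"
proof -
  let ?Z = "\<Sum>u\<in>V. slide t d x u"
  have Z: "0 < ?Z"
    by (rule slide_mass_pos[OF assms])
  have supp: "{v. slide t d x v / ?Z \<noteq> 0} = {v. slide t d x v \<noteq> 0}"
    using Z by auto
  show ?thesis
    unfolding realization_discrete_join_iff[OF finite_V] supp
  proof (intro conjI allI)
    show "0 \<le> slide t d x v / ?Z" for v
      using Z slide_nonneg[OF x t(2)] by simp
    show "{v. slide t d x v \<noteq> 0} \<subseteq> V"
      using off_base_subset by (auto simp: slide_def)
    show "inj_on l {v. slide t d x v \<noteq> 0}"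
      by (rule slide_support_inj[OF x t d(1)])
    show "(\<Sum>v\<in>V. slide t d x v / ?Z) = 1"
      using Z by (simp add: sum_divide_distrib[symmetric])
  qed
qed

lemma slide_0:
  assumes "x \<in> realization_set J"
  shows "slide 0 d x v / (\<Sum>u\<in>V. slide 0 d x u) = x v"
proof -
  have "slide 0 d x = x"
    using assms off_mass_nonneg[OF assms] off_base_subset
    unfolding realization_discrete_join_iff[OF finite_V] by (auto simp: slide_def fun_eq_iff)
  then show ?thesis
    using assms unfolding realization_discrete_join_iff[OF finite_V] by simp
qed

text \<open>
  The push is a homotopy to a constant map, provided that at time \<open>1/2\<close> the direction \<open>d\<close> differs from the
  level masses of \<open>f s\<close> for every \<open>s\<close>. These masses sum to \<open>1\<close> wherever they matter, so \<open>k - 1\<close> of them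
  count, which is more than the dimension \<open>i\<close>. A small perturbation \<open>e\<close>
  therefore makes them miss a point \<open>c\<close> of the open simplex: \<open>off_mass (f s) - e s \<noteq> c\<close>. Hence the
  direction \<open>c + e s\<close> is never the vector of level masses of \<open>f s\<close>. It is deformed to the constant
  direction \<open>c\<close> at time \<open>1\<close>, so that the push ends in a single point.
\<close>

lemma sphere_map_null_homotopic:
  assumes i: "i + 2 \<le> k" and f: "continuous_map (nsphere i) (realization J) f"
  shows "\<exists>c. homotopic_with (\<lambda>_. True) (nsphere i) (realization J) f (\<lambda>_. c)"
proof -
  let ?S = "topspace (nsphere i)"
  define n where "n = k - 1"
  have n: "i < n" "k = Suc n" "k > 0"
    using i by (auto simp: n_def)
  have fc: "continuous_on ?S f" and fJ: "\<And>s. s \<in> ?S \<Longrightarrow> f s \<in> realization_set J"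
    using f continuous_map_realization_iff[of ?S J f] nsphere_eq_top_of_set[of i] by auto
  have fv: "continuous_on ?S (\<lambda>s. f s v)" for v
    using fc by (rule continuous_on_product_then_coordinatewise)
  have offc: "continuous_on ?S (\<lambda>s. off_mass (f s) j)" for j
    unfolding off_mass_def by (intro continuous_intros fv)
  \<comment> \<open>These bounds keep all entries of \<open>c + 2 * e\<close> positive, the last one included, which makes
      the sum of \<open>c\<close> equal to \<open>1\<close> and that of \<open>e\<close> equal to \<open>0\<close>.\<close>
  obtain c e where c: "\<forall>j<n. 1 / (2 * real k) \<le> c j \<and> c j \<le> 1 / real k"
    and e: "\<forall>j<n. continuous_on ?S (e j)" "\<forall>j<n. \<forall>s\<in>?S. \<bar>e j s\<bar> < 1 / (5 * real k ^ 2)"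
    and miss: "\<forall>s\<in>?S. \<exists>j<n. off_mass (f s) j - e j s \<noteq> c j"
  proof (rule perturbation_misses_point[of n i "\<lambda>j s. off_mass (f s) j"
        "1 / (2 * real k)" "1 / real k" "1 / (5 * real k ^ 2)"])
    show "1 / (2 * real k) < 1 / real k"
      using n by (simp add: field_simps)
  qed (use n offc in auto)
  define c' where "c' j = (if j < n then c j else 1 - (\<Sum>j<n. c j))" for j
  define e' where "e' j s = (if j < n then e j s else - (\<Sum>j<n. e j s))" for j s
  have c'_sum: "(\<Sum>j<k. c' j) = 1" and e'_sum: "(\<Sum>j<k. e' j s) = 0" for s
    by (auto simp: n(2) c'_def e'_def)
  have c'_ge: "1 / (2 * real k) \<le> c' j" for j
  proof (cases "j < n")
    case False
    have "(\<Sum>j<n. c j) \<le> real n * (1 / real k)"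
      using sum_bounded_above[of "{..<n}" c "1 / real k"] c by simp
    moreover have "1 - real n * (1 / real k) = 1 / real k"
      using n(2) by (simp add: field_simps)
    moreover have "1 / (2 * real k) \<le> 1 / real k"
      using n by (simp add: field_simps)
    ultimately have "1 / (2 * real k) \<le> 1 - (\<Sum>j<n. c j)"
      by linarith
    then show ?thesis using False by (simp add: c'_def)
  qed (use c in \<open>simp add: c'_def\<close>)
  have eps: "1 / (5 * real k) = real k * (1 / (5 * real k ^ 2))"
    using n by (simp add: power2_eq_square)
  have e'_small: "\<bar>e' j s\<bar> \<le> 1 / (5 * real k)" if s: "s \<in> ?S" for j s
  proof (cases "j < n")
    case True
    have "1 * (1 / (5 * real k ^ 2)) \<le> 1 / (5 * real k)"
      unfolding eps using n by (intro mult_right_mono) auto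
    then show ?thesis
      using True e(2) s by (fastforce simp: e'_def)
  next
    case False
    have "\<bar>\<Sum>j<n. e j s\<bar> \<le> (\<Sum>j<n. \<bar>e j s\<bar>)"
      by (rule sum_abs)
    also have "\<dots> \<le> real n * (1 / (5 * real k ^ 2))"
      using sum_bounded_above[of "{..<n}" "\<lambda>j. \<bar>e j s\<bar>" "1 / (5 * real k ^ 2)"] e(2) s
      by (simp add: less_imp_le)
    also have "\<dots> \<le> 1 / (5 * real k)"
      unfolding eps using n by (intro mult_right_mono) auto
    finally show ?thesis using False by (simp add: e'_def)
  qed
  have e'c: "continuous_on ?S (e' j)" for j
  proof (cases "j < n")
    case True
    then have "e' j = e j"
      by (simp add: e'_def fun_eq_iff)
    then show ?thesis using e(1) True by simp
  next
    case False
    then have "e' j = (\<lambda>s. - (\<Sum>j<n. e j s))"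
      by (simp add: e'_def fun_eq_iff)
    then show ?thesis using e(1) by (auto intro!: continuous_intros)
  qed
  \<comment> \<open>\<open>c\<close> at time \<open>1\<close>, and \<open>c + e\<close> at the critical time \<open>1/2\<close>\<close>
  define d where "d t s j = c' j + 2 * (1 - t) * e' j s" for t s j
  have d_pos: "0 < d t s j" if "t \<in> {0..1}" "s \<in> ?S" for t s j
  proof -
    have "\<bar>2 * (1 - t) * e' j s\<bar> \<le> 2 * (1 / (5 * real k))"
      unfolding abs_mult by (intro mult_mono) (use that e'_small in auto)
    moreover have "2 * (1 / (5 * real k)) < 1 / (2 * real k)"
      using n by (simp add: field_simps)
    ultimately show ?thesis
      using c'_ge[of j] unfolding d_def by linarith
  qed
  have d_sum: "(\<Sum>j<k. d t s j) = 1" for t s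
    unfolding d_def sum.distrib sum_distrib_left[symmetric] c'_sum e'_sum by simp
  have d_avoid: "\<exists>j<k. off_mass (f s) j \<noteq> d t s j" if t: "t = 1/2" and s: "s \<in> ?S" for t s
  proof -
    obtain j where "j < n" "off_mass (f s) j - e j s \<noteq> c j"
      using miss s by blast
    then show ?thesis
      using t n(2) by (intro exI[of _ j]) (auto simp: d_def c'_def e'_def)
  qed
  define Z where "Z t s = (\<Sum>v\<in>V. slide t (d t s) (f s) v)" for t s
  define h where "h z = (\<lambda>v. slide (fst z) (d (fst z) (snd z)) (f (snd z)) v / Z (fst z) (snd z))" for z
  \<comment> \<open>At time \<open>1\<close> the pushed point has the factor \<open>0\<close>, so any point can stand in for it.\<close>
  define pt where "pt = (\<lambda>v. slide 1 c' undefined v / (\<Sum>v\<in>V. slide 1 c' undefined v))"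
  have hJ: "h z \<in> realization_set J" if "z \<in> {0..1} \<times> ?S" for z
    unfolding h_def Z_def
    by (rule slide_in_realization) (use that fJ d_pos d_sum d_avoid in auto)
  have slide_cont: "continuous_on ({0..1} \<times> ?S) (\<lambda>z. slide (fst z) (d (fst z) (snd z)) (f (snd z)) v)" for v
  proof -
    have f2: "continuous_on ({0..1} \<times> ?S) (\<lambda>z. f (snd z) v)" for v
      by (rule continuous_on_compose2[OF fv continuous_on_snd]) (auto intro: continuous_on_id)
    have e2: "continuous_on ({0..1} \<times> ?S) (\<lambda>z. e' j (snd z))" for j
      by (rule continuous_on_compose2[OF e'c continuous_on_snd]) (auto intro: continuous_on_id)
    have off2: "continuous_on ({0..1} \<times> ?S) (\<lambda>z. off_mass (f (snd z)) j)" for j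
      by (rule continuous_on_compose2[OF offc continuous_on_snd]) (auto intro: continuous_on_id)
    have d2: "continuous_on ({0..1} \<times> ?S) (\<lambda>z. d (fst z) (snd z) j)" for j
      unfolding d_def by (intro continuous_intros e2)
    show ?thesis
      unfolding slide_def
      by (cases "v \<in> off_base"; cases "v \<in> V") (auto intro!: continuous_intros f2 off2 d2)
  qed
  have hc: "continuous_on ({0..1} \<times> ?S) h"
  proof (rule continuous_on_coordinatewise_then_product)
    fix v
    have "0 < Z (fst z) (snd z)" if "z \<in> {0..1} \<times> ?S" for z
      unfolding Z_def by (rule slide_mass_pos) (use that fJ d_pos d_sum d_avoid in auto)
    then have nz: "\<forall>z\<in>{0..1} \<times> ?S. Z (fst z) (snd z) \<noteq> 0"
      by fastforce
    have "continuous_on ({0..1} \<times> ?S) (\<lambda>z. Z (fst z) (snd z))"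
      unfolding Z_def by (rule continuous_on_sum) (rule slide_cont)
    then show "continuous_on ({0..1} \<times> ?S) (\<lambda>z. h z v)"
      unfolding h_def by (rule continuous_on_divide[OF slide_cont _ nz])
  qed
  have h0: "h (0, s) = f s" if "s \<in> ?S" for s
    using slide_0[OF fJ[OF that]] by (simp add: h_def Z_def)
  have h1: "h (1, s) = pt" for s
  proof -
    have "slide 1 (d 1 s) (f s) v = slide 1 c' undefined v" for v
      by (simp add: slide_def d_def)
    then show ?thesis
      by (simp add: h_def Z_def pt_def)
  qed
  have "continuous_map (prod_topology (top_of_set {0..1::real}) (nsphere i)) (realization J) h"
  proof -
    have "prod_topology (top_of_set {0..1::real}) (nsphere i) = top_of_set ({0..1} \<times> ?S)"
      by (subst nsphere_eq_top_of_set) simp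
    then show ?thesis
      using hJ hc by (auto simp: continuous_map_realization_iff)
  qed
  then have "homotopic_with (\<lambda>_. True) (nsphere i) (realization J) f (\<lambda>_. pt)"
    using h0 h1 by (subst homotopic_with) (auto intro!: exI[of _ h])
  then show ?thesis by blast
qed

end

lemma k_connected_discrete_join:
  assumes "finite V" and levels: "l ` V = {..<k}"
  shows "k_connected (int k - 2) (realization (discrete_join V l))"
proof -
  have "\<forall>j. \<exists>v. j < k \<longrightarrow> v \<in> V \<and> l v = j"
    using levels by (metis imageE lessThan_iff)
  then obtain p where p: "\<And>j. j < k \<Longrightarrow> p j \<in> V \<and> l (p j) = j"
    by metis
  interpret pointed_join V l k p
    by unfold_locales (use assms p in auto)
  have "topspace (realization J) \<noteq> {}" if "1 \<le> k"
  proof -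
    let ?x = "\<lambda>v. if v = p 0 then 1 else (0::real)"
    have "{v. ?x v \<noteq> 0} = {p 0}" by auto
    moreover have "(\<Sum>v\<in>V. ?x v) = 1"
      using \<open>finite V\<close> base_in[of 0] that by simp
    ultimately have "?x \<in> realization_set J"
      using base_in[of 0] that unfolding realization_discrete_join_iff[OF \<open>finite V\<close>] by simp
    then show ?thesis
      by (auto simp: realization_eq_top_of_set)
  qed
  then show ?thesis
    unfolding k_connected_def using sphere_map_null_homotopic by auto
qed

section \<open>The join of copies of a finite group\<close>

text \<open>
  The \<open>k\<close>-fold join of the discrete set \<open>G\<close>. Its vertices are renamed by an injection \<open>code\<close>, because
  the index is defined through complexes whose vertices are natural numbers.
\<close>

locale group_join = group G for G :: "('g, 'b) monoid_scheme" (structure) +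
  fixes k :: nat and code :: "'g \<times> nat \<Rightarrow> 'w"
  assumes finite_G: "finite (carrier G)" and inj_code: "inj_on code (carrier G \<times> {..<k})"
begin

definition V :: "'w set" where
  "V = code ` (carrier G \<times> {..<k})"

definition decode :: "'w \<Rightarrow> 'g \<times> nat" where
  "decode = inv_into (carrier G \<times> {..<k}) code"

definition level :: "'w \<Rightarrow> nat" where
  "level v = snd (decode v)"

definition translate :: "'g \<Rightarrow> 'w \<Rightarrow> 'w" where
  "translate h = (\<lambda>v\<in>V. code (label_action G h (decode v)))"

abbreviation E :: "'w set set" where
  "E \<equiv> discrete_join V level"

lemma finite_V: "finite V"
  by (simp add: V_def finite_G)

lemma decode_code [simp]: "g \<in> carrier G \<Longrightarrow> j < k \<Longrightarrow> decode (code (g, j)) = (g, j)"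
  unfolding decode_def by (rule inv_into_f_f[OF inj_code]) auto

lemma code_in_V [simp]: "g \<in> carrier G \<Longrightarrow> j < k \<Longrightarrow> code (g, j) \<in> V"
  by (auto simp: V_def)

lemma level_code [simp]: "g \<in> carrier G \<Longrightarrow> j < k \<Longrightarrow> level (code (g, j)) = j"
  by (simp add: level_def)

lemma V_cases:
  assumes "v \<in> V"
  obtains g j where "g \<in> carrier G" "j < k" "v = code (g, j)"
  using assms by (auto simp: V_def)

lemma code_eq_iff:
  "\<lbrakk>g \<in> carrier G; j < k; g' \<in> carrier G; j' < k\<rbrakk> \<Longrightarrow>
     code (g, j) = code (g', j') \<longleftrightarrow> g = g' \<and> j = j'"
  using inj_code by (auto dest: inj_onD)

lemma translate_code [simp]:
  "\<lbrakk>h \<in> carrier G; g \<in> carrier G; j < k\<rbrakk> \<Longrightarrow> translate h (code (g, j)) = code (h \<otimes> g, j)"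
  by (simp add: translate_def label_action_def)

lemma level_image: "level ` V = {..<k}"
proof
  show "level ` V \<subseteq> {..<k}"
    by (auto elim!: V_cases)
  show "{..<k} \<subseteq> level ` V"
    by (metis code_in_V image_eqI lessThan_iff level_code one_closed subsetI)
qed

lemma translate_in_V: "h \<in> carrier G \<Longrightarrow> v \<in> V \<Longrightarrow> translate h v \<in> V"
  by (auto elim!: V_cases)

lemma level_translate: "h \<in> carrier G \<Longrightarrow> v \<in> V \<Longrightarrow> level (translate h v) = level v"
  by (auto elim!: V_cases)

lemma translate_translate:
  "\<lbrakk>h \<in> carrier G; h' \<in> carrier G; v \<in> V\<rbrakk> \<Longrightarrow> translate h (translate h' v) = translate (h \<otimes> h') v"
  by (auto elim!: V_cases simp: m_assoc)

lemma translate_one: "v \<in> V \<Longrightarrow> translate \<one> v = v"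
  by (auto elim!: V_cases)

lemma translate_Bij:
  assumes h: "h \<in> carrier G"
  shows "translate h \<in> Bij V"
proof -
  have "bij_betw (translate h) V V"
    by (rule bij_betw_byWitness[where f' = "translate (inv h)"])
      (use h in \<open>auto simp: translate_translate translate_one translate_in_V\<close>)
  then show ?thesis
    by (simp add: Bij_def translate_def)
qed

lemma translate_action: "group_action G V translate"
proof -
  have "translate \<in> hom G (BijGroup V)"
  proof (rule homI)
    fix h h' assume h: "h \<in> carrier G" "h' \<in> carrier G"
    have "translate (h \<otimes> h') = compose V (translate h) (translate h')"
      using h by (auto simp: compose_def translate_translate fun_eq_iff) (simp add: translate_def)
    then show "translate (h \<otimes> h') = translate h \<otimes>\<^bsub>BijGroup V\<^esub> translate h'"
      using h by (simp add: BijGroup_def translate_Bij)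
  qed (simp add: BijGroup_def translate_Bij)
  then show ?thesis
    by (simp add: group_action_def group_hom_def group_hom_axioms_def group_BijGroup group_axioms)
qed

lemma vertices_E: "vertices E = V"
proof
  show "V \<subseteq> vertices E"
    by (auto simp: discrete_join_def intro!: exI[of _ "{_}"])
qed (auto simp: discrete_join_def)

lemma finite_complex_E: "finite_complex E"
proof -
  have "E \<subseteq> Pow V"
    by (auto simp: discrete_join_def)
  then have "finite E"
    using finite_V by (meson finite_Pow_iff finite_subset)
  then show ?thesis
    using finite_V unfolding finite_complex_def
    by (auto simp: discrete_join_def dest: finite_subset inj_on_subset)
qed

text \<open>
  A translation keeps levels, and a simplex has one vertex per level, so a simplex that is mapped
  to itself is fixed pointwise.
\<close>

lemma free_E: "free_G_complex G E translate"
proof -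
  have "translate h ` s \<in> E" if "h \<in> carrier G" "s \<in> E" for h s
    using that translate_in_V level_translate unfolding discrete_join_def
    by (auto simp: inj_on_def) (metis subsetD)
  moreover have "h = \<one>" if h: "h \<in> carrier G" and s: "s \<in> E" and fixed: "translate h ` s = s" for h s
  proof -
    obtain v where v: "v \<in> s" "v \<in> V"
      using s by (auto simp: discrete_join_def)
    have "translate h v = v"
    proof (rule inj_onD)
      show "inj_on level s"
        using s by (simp add: discrete_join_def)
      show "translate h v \<in> s"
        using fixed v by blast
    qed (use v h level_translate in auto)
    moreover obtain g j where "g \<in> carrier G" "j < k" "v = code (g, j)"
      using v(2) by (rule V_cases)
    ultimately show ?thesis
      using h by (simp add: code_eq_iff)
  qed
  ultimately show ?thesis
    unfolding free_G_complex_def G_complex_def vertices_E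
    using finite_complex_E translate_action by blast
qed

lemma complex_dim_E: "complex_dim E = int k - 1"
proof (cases "k = 0")
  case True
  then have "V = {}"
    unfolding V_def by simp
  then have "E = {}"
    by (auto simp: discrete_join_def)
  then show ?thesis
    using True by (simp add: complex_dim_def)
next
  case False
  define s where "s = (\<lambda>j. code (\<one>, j)) ` {..<k}"
  have s: "s \<in> E"
    using False by (auto simp: s_def discrete_join_def inj_on_def)
  have "card s = k"
    unfolding s_def by (subst card_image) (auto simp: inj_on_def code_eq_iff)
  have "Max (card ` E) = k"
  proof (rule Max_eqI)
    show "finite (card ` E)"
      using finite_complex_E by (simp add: finite_complex_def)
    show "k \<in> card ` E"
      using s \<open>card s = k\<close> by force
    fix c assume "c \<in> card ` E"
    then obtain t where t: "c = card t" "t \<subseteq> V" "inj_on level t"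
      by (auto simp: discrete_join_def)
    then have "card t \<le> card {..<k}"
      using level_image by (intro card_inj_on_le[of level]) auto
    then show "c \<le> k"
      using t by simp
  qed
  then show ?thesis
    using s by (auto simp: complex_dim_def)
qed

lemma is_EnG_E: "is_EnG G (int k - 1) E translate"
  using free_E complex_dim_E k_connected_discrete_join[OF finite_V level_image]
  by (simp add: is_EnG_def)

end

section \<open>Upper bounds for the index\<close>

text \<open>
  A stand-in for the barycentric coordinate of \<open>S\<close> in the barycentric subdivision: for \<open>x \<ge> 0\<close> it is nonzero
  exactly if \<open>x\<close> is positive on \<open>S\<close> and larger there than anywhere else in \<open>V\<close>. As a polynomial in
  differences and maxima it is evidently continuous, and it makes the subdivision dispensable.
\<close>

definition flag_weight :: "'v set \<Rightarrow> 'v set \<Rightarrow> ('v \<Rightarrow> real) \<Rightarrow> real" where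
  "flag_weight V S x = (\<Prod>v\<in>S. x v) * (\<Prod>v\<in>S. \<Prod>w\<in>V - S. max 0 (x v - x w))"

lemma flag_weight_nonneg: "(\<And>v. 0 \<le> x v) \<Longrightarrow> 0 \<le> flag_weight V S x"
  unfolding flag_weight_def by (intro mult_nonneg_nonneg prod_nonneg ballI) auto

text \<open>
  If \<open>u\<close> lies only in \<open>S\<close> and \<open>w\<close> only in \<open>S'\<close>, then \<open>x u > x w\<close> and \<open>x w > x u\<close>.
\<close>

lemma flag_weight_chain:
  assumes "finite V" and "S \<subseteq> V" "S' \<subseteq> V"
    and nz: "flag_weight V S x \<noteq> 0" "flag_weight V S' x \<noteq> 0"
  shows "S \<subseteq> S' \<or> S' \<subseteq> S"
proof (rule ccontr)
  assume "\<not> ?thesis"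
  then obtain u w where uw: "u \<in> S - S'" "w \<in> S' - S" by blast
  have fin: "finite S" "finite S'" "finite (V - S)" "finite (V - S')"
    using assms finite_subset by blast+
  have "max 0 (x u - x w) \<noteq> 0" "max 0 (x w - x u) \<noteq> 0"
    using nz uw assms(2,3) fin unfolding flag_weight_def by (auto simp: subset_iff)
  then show False by (simp add: max_def split: if_splits)
qed

lemma flag_weight_image:
  assumes "bij_betw p V V" and "S \<subseteq> V" and "\<And>v. v \<in> V \<Longrightarrow> x' (p v) = x v"
  shows "flag_weight V (p ` S) x' = flag_weight V S x"
proof -
  have inj: "inj_on p V" and im: "p ` V = V"
    using assms(1) by (auto simp: bij_betw_def)
  have compl: "V - p ` S = p ` (V - S)"
    using inj_on_image_set_diff[OF inj _ assms(2)] im by auto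
  have injs: "inj_on p S" "inj_on p (V - S)"
    using inj assms(2) by (auto intro: inj_on_subset)
  have "(\<Prod>v\<in>p ` S. x' v) = (\<Prod>v\<in>S. x v)"
    using assms(2,3) by (subst prod.reindex[OF injs(1)]) (auto intro!: prod.cong)
  moreover have "(\<Prod>v\<in>p ` S. \<Prod>w\<in>V - p ` S. max 0 (x' v - x' w)) =
      (\<Prod>v\<in>S. \<Prod>w\<in>V - S. max 0 (x v - x w))"
    unfolding compl prod.reindex[OF injs(1)] prod.reindex[OF injs(2)]
    using assms(2,3) by (auto intro!: prod.cong simp: subset_iff)
  ultimately show ?thesis
    by (simp add: flag_weight_def)
qed

lemma flag_weight_support_pos:
  assumes "\<And>v. 0 \<le> x v" and "finite V" and "{v. x v \<noteq> 0} \<subseteq> V"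
  shows "0 < flag_weight V {v. x v \<noteq> 0} x"
proof -
  have pos: "0 < x v" if "x v \<noteq> 0" for v
    using assms(1)[of v] that by simp
  then show ?thesis
    unfolding flag_weight_def by (intro mult_pos_pos prod_pos ballI) auto
qed

text \<open>
  The hypotheses say that \<open>F\<close> is an equivariant simplicial map from the barycentric subdivision of \<open>T\<close>
  to the \<open>k\<close>-fold join of \<open>G\<close>: along a chain of simplices, equal levels come with equal group
  elements. The continuous map sends \<open>x\<close> to the sum of the vertices \<open>F S\<close> with the normalized flag
  weights of \<open>S\<close> at \<open>x\<close>. The simplices of nonzero weight form a chain, so the image lies in the join.
\<close>

lemma complex_index_le:
  fixes G :: "('g, 'b) monoid_scheme" and F :: "'v set \<Rightarrow> 'g \<times> nat"
  assumes "group G" and "finite (carrier G)" and T: "G_complex G T \<phi>"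
    and F: "\<And>S. S \<in> T \<Longrightarrow> F S \<in> carrier G \<times> {..<k}"
    and F_equiv: "\<And>h S. h \<in> carrier G \<Longrightarrow> S \<in> T \<Longrightarrow> F (\<phi> h ` S) = label_action G h (F S)"
    and F_chain: "\<And>S S'. \<lbrakk>S \<in> T; S' \<in> T; S \<subseteq> S'; snd (F S) = snd (F S')\<rbrakk> \<Longrightarrow> F S = F S'"
  shows "complex_index G T \<phi> \<le> ereal (real k - 1)"
proof -
  interpret group G by fact
  obtain enc :: "'g \<Rightarrow> nat" where enc: "inj_on enc (carrier G)"
    using assms(2) finite_imp_inj_to_nat_seg by blast
  define code where "code = (\<lambda>(g, j). prod_encode (enc g, j))"
  interpret group_join G k code
    by unfold_locales (use enc assms(2) in \<open>auto simp: code_def inj_on_def\<close>)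
  let ?V = "vertices T"
  interpret act: group_action G ?V \<phi>
    using T by (simp add: G_complex_def)
  have finT: "finite T" and finS: "\<And>S. S \<in> T \<Longrightarrow> finite S"
    using T by (auto simp: G_complex_def finite_complex_def)
  then have finV: "finite ?V" by auto
  have bij: "bij_betw (\<phi> h) ?V ?V" if "h \<in> carrier G" for h
    using act.bij_prop0[OF that] by (simp add: Bij_def)
  have nonneg: "0 \<le> x v" and supp: "{v. x v \<noteq> 0} \<in> T" if "x \<in> realization_set T" for x v
    using that by (auto simp: realization_set_def)
  define W where "W x = (\<Sum>S\<in>T. flag_weight ?V S x)" for x
  define f where "f x w = (\<Sum>S | S \<in> T \<and> code (F S) = w. flag_weight ?V S x) / W x" for x w
  have codeF: "code (F S) \<in> V" "level (code (F S)) = snd (F S)" "translate h (code (F S)) = code (label_action G h (F S))"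
    if "S \<in> T" "h \<in> carrier G" for S h
    using F[OF that(1)] that(2) by (auto simp: label_action_def)
  have W_pos: "0 < W x" if x: "x \<in> realization_set T" for x
    unfolding W_def
  proof (rule sum_pos2[OF finT supp[OF x]])
    show "0 < flag_weight ?V {v. x v \<noteq> 0} x"
      by (rule flag_weight_support_pos) (use nonneg[OF x] finV supp[OF x] in auto)
  qed (use flag_weight_nonneg nonneg[OF x] in blast)
  have f_in: "f x \<in> realization_set E" if x: "x \<in> realization_set T" for x
  proof -
    have witness: "\<exists>S\<in>T. code (F S) = w \<and> flag_weight ?V S x \<noteq> 0" if "f x w \<noteq> 0" for w
    proof (rule ccontr)
      assume "\<not> ?thesis"
      then have "(\<Sum>S | S \<in> T \<and> code (F S) = w. flag_weight ?V S x) = 0"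
        by (intro sum.neutral) auto
      then show False
        using that by (simp add: f_def)
    qed
    show ?thesis
      unfolding realization_discrete_join_iff[OF finite_V]
    proof (intro conjI allI)
      show "0 \<le> f x w" for w
        unfolding f_def using W_pos[OF x] nonneg[OF x]
        by (intro divide_nonneg_pos sum_nonneg flag_weight_nonneg) auto
      show "{w. f x w \<noteq> 0} \<subseteq> V"
        using witness codeF(1) by blast
      show "inj_on level {w. f x w \<noteq> 0}"
      proof (rule inj_onI)
        fix w w' assume w: "w \<in> {w. f x w \<noteq> 0}" "w' \<in> {w. f x w \<noteq> 0}" and l: "level w = level w'"
        obtain S where S: "S \<in> T" "code (F S) = w" "flag_weight ?V S x \<noteq> 0"
          using witness w(1) by blast
        obtain S' where S': "S' \<in> T" "code (F S') = w'" "flag_weight ?V S' x \<noteq> 0"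
          using witness w(2) by blast
        have "snd (F S) = snd (F S')"
          using l codeF(2) S(1,2) S'(1,2) one_closed by metis
        moreover have "S \<subseteq> S' \<or> S' \<subseteq> S"
          by (rule flag_weight_chain[OF finV _ _ S(3) S'(3)]) (use S(1) S'(1) in auto)
        ultimately have "F S = F S'"
          using F_chain S(1) S'(1) by metis
        then show "w = w'"
          using S(2) S'(2) by simp
      qed
      have "(\<Sum>w\<in>V. \<Sum>S | S \<in> T \<and> code (F S) = w. flag_weight ?V S x) = W x"
        unfolding W_def by (rule sum.group[OF finT finite_V]) (use codeF(1) one_closed in blast)
      then show "(\<Sum>w\<in>V. f x w) = 1"
        using W_pos[OF x] by (simp add: f_def sum_divide_distrib[symmetric])
    qed
  qed
  have weight_cont: "continuous_on A (flag_weight ?V S)" for S A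
    unfolding flag_weight_def by (intro continuous_intros)
  have f_cont: "continuous_on (realization_set T) f"
  proof (rule continuous_on_coordinatewise_then_product)
    fix w
    have "\<forall>x\<in>realization_set T. W x \<noteq> 0"
      using W_pos by fastforce
    then show "continuous_on (realization_set T) (\<lambda>x. f x w)"
      unfolding f_def
      by (intro continuous_on_divide continuous_on_sum weight_cont) (auto simp: W_def intro!: continuous_on_sum weight_cont)
  qed
  have f_equiv: "f (realization_map T (\<phi> h) x) = realization_map E (translate h) (f x)"
    if h: "h \<in> carrier G" and x: "x \<in> realization_set T" for h x
  proof
    fix w'
    let ?x' = "realization_map T (\<phi> h) x"
    have x': "?x' (\<phi> h v) = x v" if v: "v \<in> ?V" for v
    proof -
      have "{u. u \<in> ?V \<and> \<phi> h u = \<phi> h v} = {v}"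
        using bij[OF h] v by (auto simp: bij_betw_def dest: inj_onD)
      then show ?thesis
        by (simp add: realization_map_def)
    qed
    have weight: "flag_weight ?V (\<phi> h ` S) ?x' = flag_weight ?V S x" if "S \<in> T" for S
      by (rule flag_weight_image[OF bij[OF h]]) (use x' that in auto)
    have hT: "\<phi> g ` S \<in> T" if "g \<in> carrier G" "S \<in> T" for g S
      using T that by (simp add: G_complex_def)
    have inv_act: "\<phi> (inv\<^bsub>G\<^esub> g) ` \<phi> g ` S = S" if "g \<in> carrier G" "S \<in> T" for g S
    proof -
      have "\<phi> (inv\<^bsub>G\<^esub> g) (\<phi> g v) = v" if "v \<in> S" for v
        using act.orbit_sym_aux[OF \<open>g \<in> carrier G\<close> _ refl] that \<open>S \<in> T\<close> by auto
      then show ?thesis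
        by (force simp: image_image)
    qed
    have bijT: "bij_betw ((`) (\<phi> h)) T T"
    proof (rule bij_betw_byWitness[where f' = "(`) (\<phi> (inv\<^bsub>G\<^esub> h))"])
      show "\<forall>S\<in>T. \<phi> h ` \<phi> (inv\<^bsub>G\<^esub> h) ` S = S"
        using inv_act[of "inv\<^bsub>G\<^esub> h"] h by simp
    qed (use h hT inv_act in auto)
    have W_eq: "W ?x' = W x"
      unfolding W_def by (subst sum.reindex_bij_betw[OF bijT, symmetric]) (simp add: weight)
    show "f ?x' w' = realization_map E (translate h) (f x) w'"
    proof (cases "w' \<in> V")
      case False
      then have none: "{S. S \<in> T \<and> code (F S) = w'} = {}" "{w. w \<in> V \<and> translate h w = w'} = {}"
        using codeF(1) translate_in_V h by auto
      have "f ?x' w' = 0"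
        by (simp only: f_def none sum.empty div_0)
      moreover have "realization_map E (translate h) (f x) w' = 0"
        by (simp only: realization_map_def vertices_E none sum.empty)
      ultimately show ?thesis by simp
    next
      case True
      have inj: "inj_on (translate h) V" and "translate h ` V = V"
        using translate_Bij[OF h] by (simp_all add: Bij_def bij_betw_def)
      then obtain w where w: "w \<in> V" "w' = translate h w"
        using True by blast
      then have fibre: "{u. u \<in> V \<and> translate h u = w'} = {w}"
        using w inj by (auto dest: inj_onD)
      have "bij_betw ((`) (\<phi> h)) {S. S \<in> T \<and> code (F S) = w} {S. S \<in> T \<and> code (F S) = w'}"
      proof (rule bij_betw_subset[OF bijT])
        have shift: "code (F (\<phi> h ` S)) = w' \<longleftrightarrow> code (F S) = w" if "S \<in> T" for S
        proof -
          have "code (F (\<phi> h ` S)) = translate h (code (F S))"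
            using codeF(3) F_equiv h that by simp
          then show ?thesis
            using w inj codeF(1)[OF that h] by (auto dest: inj_onD)
        qed
        show "(`) (\<phi> h) ` {S. S \<in> T \<and> code (F S) = w} = {S. S \<in> T \<and> code (F S) = w'}"
        proof (intro equalityI subsetI)
          fix S' assume S': "S' \<in> {S. S \<in> T \<and> code (F S) = w'}"
          then have "S' \<in> (`) (\<phi> h) ` T"
            using bijT by (simp add: bij_betw_def)
          then obtain S where "S \<in> T" "S' = \<phi> h ` S"
            by blast
          then show "S' \<in> (`) (\<phi> h) ` {S. S \<in> T \<and> code (F S) = w}"
            using S' shift by auto
        qed (use shift hT h in auto)
      qed auto
      then have "(\<Sum>S | S \<in> T \<and> code (F S) = w'. flag_weight ?V S ?x') =
          (\<Sum>S | S \<in> T \<and> code (F S) = w. flag_weight ?V (\<phi> h ` S) ?x')"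
        by (rule sum.reindex_bij_betw[symmetric])
      also have "\<dots> = (\<Sum>S | S \<in> T \<and> code (F S) = w. flag_weight ?V S x)"
        using weight by (intro sum.cong) auto
      finally have "f ?x' w' = f x w"
        by (simp add: f_def W_eq)
      then show ?thesis
        unfolding realization_map_def vertices_E fibre by simp
    qed
  qed
  have "ereal (real k - 1) \<in> {ereal (real_of_int n) | n.
       \<exists>(E :: nat set set) \<psi> f. is_EnG G n E \<psi> \<and> continuous_map (realization T) (realization E) f \<and>
         (\<forall>h\<in>carrier G. \<forall>x\<in>topspace (realization T).
            f (realization_map T (\<phi> h) x) = realization_map E (\<psi> h) (f x))}"
  proof (intro CollectI exI conjI)
    show "ereal (real k - 1) = ereal (real_of_int (int k - 1))"
      by simp
    show "is_EnG G (int k - 1) E translate"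
      by (rule is_EnG_E)
    show "continuous_map (realization T) (realization E) f"
      unfolding realization_eq_top_of_set[of T] continuous_map_realization_iff
      using f_cont f_in by auto
    show "\<forall>h\<in>carrier G. \<forall>x\<in>topspace (realization T).
            f (realization_map T (\<phi> h) x) = realization_map E (translate h) (f x)"
      using f_equiv by (simp add: realization_eq_top_of_set)
  qed
  then show ?thesis
    unfolding complex_index_def G_index_def by (rule Inf_lower)
qed

section \<open>Alternating sequences of labels\<close>

text \<open>
  The number \<open>r\<close> counts steps, so the sequence has \<open>r + 1\<close> labels.
\<close>

definition alternating_sequence :: "('v \<Rightarrow> 'g \<times> nat) \<Rightarrow> 'v set \<Rightarrow> nat \<Rightarrow> (nat \<Rightarrow> 'v) \<Rightarrow> bool" where
  "alternating_sequence lab S r v \<longleftrightarrow> v ` {0..r} \<subseteq> S \<and>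
     (\<forall>i<r. fst (lab (v i)) \<noteq> fst (lab (v (Suc i))) \<and> snd (lab (v i)) < snd (lab (v (Suc i))))"

lemma alternating_sequence_singleton: "u \<in> S \<Longrightarrow> alternating_sequence lab S 0 (\<lambda>_. u)"
  by (simp add: alternating_sequence_def)

lemma alternating_sequence_subset:
  "alternating_sequence lab S r v \<Longrightarrow> S \<subseteq> S' \<Longrightarrow> alternating_sequence lab S' r v"
  by (auto simp: alternating_sequence_def)

lemma alternating_sequence_le:
  "alternating_sequence lab S r v \<Longrightarrow> r' \<le> r \<Longrightarrow> alternating_sequence lab S r' v"
  by (auto simp: alternating_sequence_def)

lemma alternating_sequence_Cons:
  assumes "alternating_sequence lab S r v" and "u \<in> S"
    and "fst (lab u) \<noteq> fst (lab (v 0))" and "snd (lab u) < snd (lab (v 0))"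
  shows "alternating_sequence lab S (Suc r) (\<lambda>i. case i of 0 \<Rightarrow> u | Suc i \<Rightarrow> v i)"
  using assms unfolding alternating_sequence_def by (auto simp: image_subset_iff split: nat.splits)

lemma alternating_sequence_levels:
  assumes "alternating_sequence lab S r v" and "i \<le> r"
  shows "snd (lab (v 0)) + i \<le> snd (lab (v i))"
  using assms(2)
proof (induction i)
  case (Suc i)
  then have "snd (lab (v i)) < snd (lab (v (Suc i)))"
    using assms(1) by (simp add: alternating_sequence_def)
  then show ?case using Suc by simp
qed simp

definition max_alternation :: "('v \<Rightarrow> 'g \<times> nat) \<Rightarrow> 'v set \<Rightarrow> nat" where
  "max_alternation lab S = Max {r. \<exists>v. alternating_sequence lab S r v}"

text \<open>
  Several vertices may have the lowest level; the value does not depend on the choice among them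
  if labels of equal level are equal.
\<close>

definition bottom_label :: "('v \<Rightarrow> 'g \<times> nat) \<Rightarrow> 'v set \<Rightarrow> 'g \<times> nat" where
  "bottom_label lab S = lab (arg_min_on (snd \<circ> lab) S)"

lemma bottom_label_obtains:
  assumes "finite S" and "S \<noteq> {}"
  obtains u where "u \<in> S" "lab u = bottom_label lab S" "\<And>w. w \<in> S \<Longrightarrow> snd (lab u) \<le> snd (lab w)"
proof (rule that)
  show "arg_min_on (snd \<circ> lab) S \<in> S"
    by (rule arg_min_if_finite(1)[OF assms])
  show "snd (lab (arg_min_on (snd \<circ> lab) S)) \<le> snd (lab w)" if "w \<in> S" for w
    using arg_min_least[OF assms that, of "snd \<circ> lab"] by simp
qed (simp add: bottom_label_def)

lemma max_alternation_bounded: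
  assumes "S \<noteq> {}" and "\<And>v. \<not> alternating_sequence lab S n v"
  shows "max_alternation lab S < n" and "\<exists>v. alternating_sequence lab S (max_alternation lab S) v"
    and "alternating_sequence lab S r v \<Longrightarrow> r \<le> max_alternation lab S"
proof -
  let ?R = "{r. \<exists>v. alternating_sequence lab S r v}"
  have sub: "?R \<subseteq> {..<n}"
  proof
    fix r assume "r \<in> ?R"
    then obtain v where "alternating_sequence lab S r v" by blast
    then show "r \<in> {..<n}"
      using alternating_sequence_le[of lab S r v n] assms(2)[of v] by (cases "n \<le> r") auto
  qed
  then have fin: "finite ?R"
    by (rule finite_subset) simp
  have "?R \<noteq> {}"
    using assms(1) alternating_sequence_singleton by fastforce
  then have *: "max_alternation lab S \<in> ?R"
    unfolding max_alternation_def by (rule Max_in[OF fin])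
  then show "max_alternation lab S < n" and "\<exists>v. alternating_sequence lab S (max_alternation lab S) v"
    using sub by auto
  show "r \<le> max_alternation lab S" if "alternating_sequence lab S r v"
    unfolding max_alternation_def using fin that by (intro Max_ge) auto
qed

text \<open>
  A bottom label of the larger simplex with a different group element would lie strictly lower. Put
  in front of a longest alternating sequence of \<open>S\<close> it would give a longer one in \<open>S'\<close>. This uses that a
  longest sequence in \<open>S\<close> starts with the group element of the bottom label of \<open>S\<close>, as otherwise
  that label could be put in front.
\<close>

lemma bottom_label_eq_of_max_alternation_eq:
  assumes "finite S'" and "S \<noteq> {}" and "S \<subseteq> S'"
    and bounded: "\<And>v. \<not> alternating_sequence lab S' n v"
    and cons: "\<And>u w. \<lbrakk>u \<in> S'; w \<in> S'; snd (lab u) = snd (lab w)\<rbrakk> \<Longrightarrow> lab u = lab w"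
    and eq: "max_alternation lab S = max_alternation lab S'"
  shows "fst (bottom_label lab S) = fst (bottom_label lab S')"
proof (rule ccontr)
  assume neq: "\<not> ?thesis"
  have S: "finite S" "S' \<noteq> {}" "\<not> alternating_sequence lab S n v" for v
    using finite_subset[OF assms(3,1)] assms(2,3) bounded[of v]
      alternating_sequence_subset[of lab S n v S'] by auto
  obtain u where u: "u \<in> S" "lab u = bottom_label lab S" "\<And>w. w \<in> S \<Longrightarrow> snd (lab u) \<le> snd (lab w)"
    using bottom_label_obtains[OF S(1) assms(2)] by metis
  obtain u' where u': "u' \<in> S'" "lab u' = bottom_label lab S'" "\<And>w. w \<in> S' \<Longrightarrow> snd (lab u') \<le> snd (lab w)"
    using bottom_label_obtains[OF assms(1) S(2)] by metis
  obtain v where v: "alternating_sequence lab S (max_alternation lab S) v"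
    using max_alternation_bounded(2)[OF assms(2) S(3)] by blast
  then have v0: "v 0 \<in> S"
    by (auto simp: alternating_sequence_def)
  show False
  proof (cases "fst (lab (v 0)) = fst (lab u)")
    case True
    have "snd (lab u') \<noteq> snd (lab u)"
      using cons[of u' u] u u' neq assms(3) by auto
    then have "snd (lab u') < snd (lab (v 0))"
      using u'(3)[of u] u(1) u(3)[OF v0] assms(3) by fastforce
    moreover have "fst (lab u') \<noteq> fst (lab (v 0))"
      using True u(2) u'(2) neq by simp
    ultimately have "alternating_sequence lab S' (Suc (max_alternation lab S)) (\<lambda>i. case i of 0 \<Rightarrow> u' | Suc i \<Rightarrow> v i)"
      using alternating_sequence_subset[OF v assms(3)] u'(1) by (intro alternating_sequence_Cons)
    then show False
      using max_alternation_bounded(3)[OF S(2) bounded] eq by fastforce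
  next
    case False
    then have "snd (lab u) \<noteq> snd (lab (v 0))"
      using cons[of u "v 0"] subsetD[OF assms(3) u(1)] subsetD[OF assms(3) v0] False by auto
    then have "snd (lab u) < snd (lab (v 0))"
      using u(3)[OF v0] by simp
    then have "alternating_sequence lab S (Suc (max_alternation lab S)) (\<lambda>i. case i of 0 \<Rightarrow> u | Suc i \<Rightarrow> v i)"
      using v u(1) False by (intro alternating_sequence_Cons) auto
    then show False
      using max_alternation_bounded(3)[OF assms(2) S(3)] by fastforce
  qed
qed

context group
begin

lemma max_alternation_image:
  assumes h: "h \<in> carrier G" and lab: "\<And>v. v \<in> S \<Longrightarrow> fst (lab v) \<in> carrier G"
    and equiv: "\<And>v. v \<in> S \<Longrightarrow> lab (\<phi> v) = label_action G h (lab v)"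
  shows "max_alternation lab (\<phi> ` S) = max_alternation lab S"
proof -
  have parts: "fst (lab (\<phi> v)) = h \<otimes> fst (lab v)" "snd (lab (\<phi> v)) = snd (lab v)" if "v \<in> S" for v
    using equiv[OF that] by (simp_all add: label_action_def case_prod_beta)
  have same: "alternating_sequence lab (\<phi> ` S) r (\<lambda>i. \<phi> (v i)) \<longleftrightarrow> alternating_sequence lab S r v"
    if v: "v ` {0..r} \<subseteq> S" for v r
  proof -
    have "v i \<in> S" "v (Suc i) \<in> S" if "i < r" for i
      using v that by auto
    then show ?thesis
      using v h lab parts unfolding alternating_sequence_def by auto
  qed
  have "(\<exists>v. alternating_sequence lab (\<phi> ` S) r v) \<longleftrightarrow> (\<exists>v. alternating_sequence lab S r v)" for r
  proof
    assume "\<exists>v. alternating_sequence lab (\<phi> ` S) r v"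
    then obtain w where w: "alternating_sequence lab (\<phi> ` S) r w" by blast
    then have "\<forall>i\<in>{0..r}. \<exists>u\<in>S. w i = \<phi> u"
      by (auto simp: alternating_sequence_def)
    then obtain v where v: "\<forall>i\<in>{0..r}. v i \<in> S \<and> w i = \<phi> (v i)"
      by metis
    then have "alternating_sequence lab (\<phi> ` S) r (\<lambda>i. \<phi> (v i))"
      using w by (auto simp: alternating_sequence_def)
    then show "\<exists>v. alternating_sequence lab S r v"
      using same[of v r] v by auto
  next
    assume "\<exists>v. alternating_sequence lab S r v"
    then obtain v where v: "alternating_sequence lab S r v" by blast
    then have "alternating_sequence lab (\<phi> ` S) r (\<lambda>i. \<phi> (v i))"
      using same[of v r] by (simp add: alternating_sequence_def)
    then show "\<exists>v. alternating_sequence lab (\<phi> ` S) r v"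
      by blast
  qed
  then show ?thesis
    by (simp add: max_alternation_def)
qed

lemma fst_bottom_label_image:
  assumes S: "finite S" "S \<noteq> {}" and h: "h \<in> carrier G"
    and equiv: "\<And>v. v \<in> S \<Longrightarrow> lab (\<phi> v) = label_action G h (lab v)"
    and cons: "\<And>u w. \<lbrakk>u \<in> S; w \<in> S; snd (lab u) = snd (lab w)\<rbrakk> \<Longrightarrow> lab u = lab w"
  shows "fst (bottom_label lab (\<phi> ` S)) = h \<otimes> fst (bottom_label lab S)"
proof -
  have parts: "fst (lab (\<phi> v)) = h \<otimes> fst (lab v)" "snd (lab (\<phi> v)) = snd (lab v)" if "v \<in> S" for v
    using equiv[OF that] by (simp_all add: label_action_def case_prod_beta)
  obtain u where u: "u \<in> S" "lab u = bottom_label lab S" "\<And>w. w \<in> S \<Longrightarrow> snd (lab u) \<le> snd (lab w)"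
    using bottom_label_obtains[OF S] by metis
  have im: "finite (\<phi> ` S)" "\<phi> ` S \<noteq> {}"
    using S by auto
  obtain x where x: "x \<in> \<phi> ` S" "lab x = bottom_label lab (\<phi> ` S)"
    "\<And>w. w \<in> \<phi> ` S \<Longrightarrow> snd (lab x) \<le> snd (lab w)"
    using bottom_label_obtains[OF im] by metis
  then obtain w where w: "w \<in> S" "x = \<phi> w" by blast
  have "snd (lab w) = snd (lab u)"
    using u(3)[OF w(1)] x(3)[of "\<phi> u"] parts(2) u(1) w by force
  then have "lab w = lab u"
    using cons w(1) u(1) by blast
  then show ?thesis
    using parts(1)[OF w(1)] w(2) x(2) u(2) by simp
qed

end

theorem lemma3:
  fixes G :: "('g, 'b) monoid_scheme"
    and T :: "'v set set"
    and \<phi> :: "'g \<Rightarrow> 'v \<Rightarrow> 'v"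
    and lab :: "'v \<Rightarrow> 'g \<times> nat"
    and m n :: nat
  assumes "group G" and "finite (carrier G)" and "carrier G \<noteq> {\<one>\<^bsub>G\<^esub>}"
    and "free_G_complex G T \<phi>"
    and "complex_index G T \<phi> = ereal (real n)"
    and "lab \<in> vertices T \<rightarrow> carrier G \<times> {1..m}"
    and "\<forall>h\<in>carrier G. \<forall>v\<in>vertices T. lab (\<phi> h v) = label_action G h (lab v)"
    and "\<not> (\<exists>u v g g' j. {u, v} \<in> T \<and> u \<noteq> v \<and> lab u = (g, j) \<and> lab v = (g', j) \<and>
              g \<noteq> g' \<and> j \<in> {1..m})"
  shows "(\<exists>v g j. v ` {0..n} \<in> T \<and> (\<forall>i\<in>{0..n}. lab (v i) = (g i, j i)) \<and>
            (\<forall>i<n. g i \<noteq> g (Suc i) \<and> j i < j (Suc i))) \<and>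
         m \<ge> n + 1"
proof -
  interpret group G by fact
  have T: "G_complex G T \<phi>"
    using assms(4) by (simp add: free_G_complex_def)
  have S: "finite S" "S \<noteq> {}" "S \<subseteq> vertices T" if "S \<in> T" for S
    using T that by (auto simp: G_complex_def finite_complex_def)
  have face: "t \<in> T" if "S \<in> T" "t \<subseteq> S" "t \<noteq> {}" for S t
    using T that unfolding G_complex_def finite_complex_def by blast
  have labG: "fst (lab v) \<in> carrier G" "snd (lab v) \<in> {1..m}" if "v \<in> vertices T" for v
    using funcset_mem[OF assms(6) that] by (auto simp: mem_Times_iff)
  have cons: "lab u = lab w" if "S \<in> T" "u \<in> S" "w \<in> S" "snd (lab u) = snd (lab w)" for S u w
  proof (rule ccontr)
    assume neq: "lab u \<noteq> lab w"
    have "{u, w} \<in> T"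
      by (rule face[OF that(1)]) (use that in auto)
    moreover have "u \<noteq> w" "fst (lab u) \<noteq> fst (lab w)" "snd (lab u) \<in> {1..m}"
      using neq that labG(2)[of u] by (auto simp: prod_eq_iff)
    ultimately show False
      using assms(8)[simplified not_ex, rule_format, of u w "fst (lab u)" "snd (lab u)" "fst (lab w)"]
        that(4) by (simp add: prod_eq_iff)
  qed
  \<comment> \<open>otherwise the group element at the bottom, together with the length of the alternation,
      maps \<open>T\<close> to the \<open>n\<close>-fold join of \<open>G\<close>, whose dimension is \<open>n - 1\<close>\<close>
  have "\<exists>S\<in>T. \<exists>v. alternating_sequence lab S n v"
  proof (rule ccontr)
    assume "\<not> ?thesis"
    then have none: "\<And>S v. S \<in> T \<Longrightarrow> \<not> alternating_sequence lab S n v" by blast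
    have "complex_index G T \<phi> \<le> ereal (real n - 1)"
    proof (rule complex_index_le[where F = "\<lambda>S. (fst (bottom_label lab S), max_alternation lab S)",
          OF assms(1,2) T])
      fix S assume "S \<in> T"
      then have "fst (bottom_label lab S) \<in> carrier G"
        using bottom_label_obtains[OF S(1,2)] S(3) labG(1) by (metis subsetD)
      then show "(fst (bottom_label lab S), max_alternation lab S) \<in> carrier G \<times> {..<n}"
        using max_alternation_bounded(1)[OF S(2) none] \<open>S \<in> T\<close> by simp
    next
      fix h S assume h: "h \<in> carrier G" and "S \<in> T"
      then have v: "v \<in> vertices T" "lab (\<phi> h v) = label_action G h (lab v)" if "v \<in> S" for v
        using assms(7) that by auto
      have "max_alternation lab (\<phi> h ` S) = max_alternation lab S"
        by (rule max_alternation_image[OF h]) (erule labG(1)[OF v(1)], erule v(2))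
      moreover have "fst (bottom_label lab (\<phi> h ` S)) = h \<otimes>\<^bsub>G\<^esub> fst (bottom_label lab S)"
        by (rule fst_bottom_label_image[OF S(1,2)[OF \<open>S \<in> T\<close>] h])
          (erule v(2), rule cons[OF \<open>S \<in> T\<close>])
      ultimately show "(fst (bottom_label lab (\<phi> h ` S)), max_alternation lab (\<phi> h ` S)) =
          label_action G h (fst (bottom_label lab S), max_alternation lab S)"
        by (simp add: label_action_def)
    next
      fix S S' assume ST: "S \<in> T" "S' \<in> T" "S \<subseteq> S'"
        and eq: "snd (fst (bottom_label lab S), max_alternation lab S) =
          snd (fst (bottom_label lab S'), max_alternation lab S')"
      have "fst (bottom_label lab S) = fst (bottom_label lab S')"
        by (rule bottom_label_eq_of_max_alternation_eq[OF S(1)[OF ST(2)] S(2)[OF ST(1)] ST(3)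
              none[OF ST(2)] cons[OF ST(2)]]) (use eq in simp_all)
      with eq show "(fst (bottom_label lab S), max_alternation lab S) =
          (fst (bottom_label lab S'), max_alternation lab S')"
        by simp
    qed
    then show False
      using assms(5) by simp
  qed
  then obtain S v where Sv: "S \<in> T" "alternating_sequence lab S n v" by blast
  have "v ` {0..n} \<in> T"
    by (rule face[OF Sv(1)]) (use Sv(2) in \<open>auto simp: alternating_sequence_def\<close>)
  moreover have "n + 1 \<le> m"
  proof -
    have "v 0 \<in> vertices T" "v n \<in> vertices T"
      by (rule UnionI[OF \<open>v ` {0..n} \<in> T\<close>], simp)+
    then show ?thesis
      using alternating_sequence_levels[OF Sv(2), of n] labG(2)[of "v 0"] labG(2)[of "v n"] by simp
  qed
  ultimately show ?thesis
    using Sv(2) unfolding alternating_sequence_def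
    by (intro conjI exI[of _ v] exI[of _ "\<lambda>i. fst (lab (v i))"] exI[of _ "\<lambda>i. snd (lab (v i))"]) auto
qed

end
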